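(* Let $k\ge1$ be an integer and consider the annihilation process on $T_k$ and on $T_k^1$. For $t\in[0,1]$ and an arbitrary vertex $v$ of $T_k$ set $\alpha(t)=P[X_t^{T_k}(v)=1]$ and $\beta(t)=P[X_t^{T_k^1}(v_0)=1]$; for integer $m\ge1$ let $\mathrm{Cov}(m,t,T_k):=\mathrm{Cov}(X_t^{T_k}(v),X_t^{T_k}(w))$ for vertices $v,w$ of $T_k$ at graph distance $m$. Then for $k\ge2$, $$\beta(t)=(1+(k-1)t/2)^{-1/(k-1)},\qquad\alpha(t)=(1+(k-1)t/2)^{-(k+1)/(k-1)},$$ $$\mathrm{Cov}(m,t,T_k)=\beta(t)^{2k}\left(\frac{(k+1)(2\log\beta(t))^{m-1}}{(m-1)!\,(k-1)}-\sum_{j=m-1}^\infty\left(\frac{(2\log\beta(t))^j}{j!}-\Big(\frac2{1-k}\Big)^m\frac{((1-k)\log\beta(t))^j}{j!}\right)\right),$$ and for $k=1$, $$\beta(t)=e^{-t/2},\qquad\alpha(t)=e^{-t},\qquad\mathrm{Cov}(m,t,T_1)=-e^{-t}\sum_{j=m+1}^\infty\frac{(-t)^j}{j!}.$$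
   Context: $T_k$ is the infinite $(k+1)$-regular tree (connected, acyclic, every vertex of degree $k+1$). $T_k^1$ is the infinite tree in which one vertex $v_0$ has degree $1$ and all other vertices have degree $k+1$. The probability $\alpha(t)$ does not depend on $v$, and the covariance depends on $v,w$ only through their graph distance. Convention: $0^0=1$. Annihilation process on a finite graph $V$ with edge set $E$: $\tau_e$, $e\in E$, are i.i.d. uniform on $(0,1)$. All sites are initially occupied (state $1$); at time $\tau_e$, $e=\{u,v\}$, if $u$ and $v$ are both occupied immediately before, then one of them, each with probability $1/2$ (chosen independently of everything else), becomes vacant (state $0$); otherwise nothing changes. Vacant sites stay vacant forever. $X_t^V(v)$ is the state of $v$ at time $t$. For countably infinite $V$ of bounded degree, $X_t^V(v):=\lim_n X_t^{V_n}(v)$, where $(V_n)$ is any sequence of finite subsets of $V$ with $\bigcup_n\bigcap_{m\ge n}V_m=V$ and the process on the induced subgraph $V_n$ uses the same $\tau_e$ and attack directions; almost surely this limit exists for all $v,t$ and does not depend on the sequence. *)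

theory Defs
  imports "HOL-Probability.Probability"
begin

section \<open>Graphs and trees\<close>

definition simple_graph :: "'a set \<Rightarrow> 'a set set \<Rightarrow> bool" where
  "simple_graph V E \<longleftrightarrow> (\<forall>e\<in>E. e \<subseteq> V \<and> card e = 2)"

definition adj :: "'a set set \<Rightarrow> ('a \<times> 'a) set" where
  "adj E = {(u, v). {u, v} \<in> E}"

definition connected_graph :: "'a set \<Rightarrow> 'a set set \<Rightarrow> bool" where
  "connected_graph V E \<longleftrightarrow> (\<forall>u\<in>V. \<forall>v\<in>V. (u, v) \<in> (adj E)\<^sup>*)"

definition graph_cycle :: "'a set set \<Rightarrow> 'a list \<Rightarrow> bool" where
  "graph_cycle E c \<longleftrightarrow> length c \<ge> 3 \<and> distinct c \<and>
     (\<forall>i<length c. {c ! i, c ! (Suc i mod length c)} \<in> E)"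

definition tree :: "'a set \<Rightarrow> 'a set set \<Rightarrow> bool" where
  "tree V E \<longleftrightarrow> simple_graph V E \<and> V \<noteq> {} \<and> connected_graph V E \<and> (\<nexists>c. graph_cycle E c)"

definition degree :: "'a set set \<Rightarrow> 'a \<Rightarrow> nat" where
  "degree E v = card {e\<in>E. v \<in> e}"

definition graph_dist :: "'a set set \<Rightarrow> 'a \<Rightarrow> 'a \<Rightarrow> nat" where
  "graph_dist E u v = (LEAST n. (u, v) \<in> adj E ^^ n)"

text \<open>\<open>is_T k V E\<close>: the graph \<open>(V, E)\<close> is (a copy of) \<open>T\<^sub>k\<close>;
  \<open>is_T1 k V E v\<^sub>0\<close>: it is a copy of \<open>T\<^sub>k\<^sup>1\<close> with degree-one vertex \<open>v\<^sub>0\<close>.\<close>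

definition is_T :: "nat \<Rightarrow> 'a set \<Rightarrow> 'a set set \<Rightarrow> bool" where
  "is_T k V E \<longleftrightarrow> tree V E \<and> infinite V \<and> (\<forall>v\<in>V. degree E v = k + 1)"

definition is_T1 :: "nat \<Rightarrow> 'a set \<Rightarrow> 'a set set \<Rightarrow> 'a \<Rightarrow> bool" where
  "is_T1 k V E v0 \<longleftrightarrow> tree V E \<and> infinite V \<and> v0 \<in> V \<and> degree E v0 = 1 \<and>
     (\<forall>v\<in>V - {v0}. degree E v = k + 1)"


section \<open>The annihilation process\<close>

text \<open>For a realisation of the process, \<open>\<tau> e\<close> is the time of the edge \<open>e\<close> and \<open>\<kappa> e\<close> is the
  endpoint of \<open>e\<close> that becomes vacant if both endpoints are occupied just before time \<open>\<tau> e\<close>.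
  Since sites never become occupied again, \<open>v\<close> is occupied immediately before time \<open>s\<close> iff no
  edge at \<open>v\<close> has made \<open>v\<close> vacant at a time \<open>< s\<close>. The finiteness test only serves to make the
  recursion terminate: the function is applied to the edges of finite graphs. Coinciding edge
  times (an event of probability 0) are treated as simultaneous.\<close>

context
  notes conj_cong [fundef_cong]
begin

function occupied_before ::
  "'a set set \<Rightarrow> ('a set \<Rightarrow> real) \<Rightarrow> ('a set \<Rightarrow> 'a) \<Rightarrow> real \<Rightarrow> 'a \<Rightarrow> bool" where
  "occupied_before E \<tau> \<kappa> s v \<longleftrightarrow>
     \<not> (\<exists>e\<in>E. finite E \<and> v \<in> e \<and> \<tau> e < s \<and> \<kappa> e = v \<and>
          (\<forall>u\<in>e. occupied_before E \<tau> \<kappa> (\<tau> e) u))"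
  by pat_completeness auto
termination
proof (relation "Wellfounded.measure (\<lambda>(E, \<tau>, \<kappa>, s, v). card {f\<in>E. \<tau> f < s})", goal_cases)
  case 1
  show ?case by simp
next
  case (2 E \<tau> \<kappa> s v e u)
  then have "{f\<in>E. \<tau> f < \<tau> e} \<subset> {f\<in>E. \<tau> f < s}"
    by auto
  with 2 show ?case
    by (auto intro!: psubset_card_mono)
qed

end

declare occupied_before.simps [simp del]

definition occupied_at ::
  "'a set set \<Rightarrow> ('a set \<Rightarrow> real) \<Rightarrow> ('a set \<Rightarrow> 'a) \<Rightarrow> real \<Rightarrow> 'a \<Rightarrow> bool" where
  "occupied_at E \<tau> \<kappa> t v \<longleftrightarrow>
     \<not> (\<exists>e\<in>E. v \<in> e \<and> \<tau> e \<le> t \<and> \<kappa> e = v \<and> (\<forall>u\<in>e. occupied_before E \<tau> \<kappa> (\<tau> e) u))"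

definition induced_edges :: "'a set set \<Rightarrow> 'a set \<Rightarrow> 'a set set" where
  "induced_edges E W = {e\<in>E. e \<subseteq> W}"

definition exhaustion :: "'a set \<Rightarrow> (nat \<Rightarrow> 'a set) \<Rightarrow> bool" where
  "exhaustion V W \<longleftrightarrow> (\<forall>n. finite (W n) \<and> W n \<subseteq> V) \<and> (\<Union>n. \<Inter>m\<in>{n..}. W m) = V"

text \<open>The state \<open>X\<^sub>t(v) \<in> {0, 1}\<close> of the process on an infinite graph with edge set \<open>E\<close>, as the
  limit along the sequence \<open>W\<close> of finite vertex sets.\<close>

definition ann_state :: "'a set set \<Rightarrow> (nat \<Rightarrow> 'a set) \<Rightarrow> ('a set \<Rightarrow> '\<omega> \<Rightarrow> real) \<Rightarrow>
    ('a set \<Rightarrow> '\<omega> \<Rightarrow> 'a) \<Rightarrow> real \<Rightarrow> 'a \<Rightarrow> '\<omega> \<Rightarrow> real" where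
  "ann_state E W \<tau> \<kappa> t v \<omega> =
     lim (\<lambda>n. of_bool (occupied_at (induced_edges E (W n)) (\<lambda>e. \<tau> e \<omega>) (\<lambda>e. \<kappa> e \<omega>) t v))"

text \<open>The pairs \<open>(\<tau> e, \<kappa> e)\<close> are independent, and each has as its law the product of the two
  uniform distributions; so all \<open>\<tau> e\<close> and \<open>\<kappa> e\<close> together are independent.\<close>

locale annihilation = prob_space M for M :: "'\<omega> measure" +
  fixes E :: "'a set set"
    and \<tau> :: "'a set \<Rightarrow> '\<omega> \<Rightarrow> real"
    and \<kappa> :: "'a set \<Rightarrow> '\<omega> \<Rightarrow> 'a"
  assumes indep_edges:
      "indep_vars (\<lambda>e. borel \<Otimes>\<^sub>M count_space e) (\<lambda>e \<omega>. (\<tau> e \<omega>, \<kappa> e \<omega>)) E"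
    and law_edge:
      "\<And>e. e \<in> E \<Longrightarrow> distr M (borel \<Otimes>\<^sub>M count_space e) (\<lambda>\<omega>. (\<tau> e \<omega>, \<kappa> e \<omega>)) =
         uniform_measure lborel {0<..<1} \<Otimes>\<^sub>M uniform_count_measure e"

definition covariance :: "'\<omega> measure \<Rightarrow> ('\<omega> \<Rightarrow> real) \<Rightarrow> ('\<omega> \<Rightarrow> real) \<Rightarrow> real" where
  "covariance M X Y =
     (\<integral>\<omega>. (X \<omega> - (\<integral>\<omega>. X \<omega> \<partial>M)) * (Y \<omega> - (\<integral>\<omega>. Y \<omega> \<partial>M)) \<partial>M)"

end

theory Submission
  imports Defs
begin

text \<open>
  Whether a vertex \<open>v\<close> is occupied at time \<open>s\<close> is decided by the edges that can be reached from
  \<open>v\<close> along edges with decreasing clocks. In a graph with degrees at most \<open>D\<close> such a chain of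
  length \<open>d\<close> exists with probability at most \<open>(D s)\<^sup>d / d!\<close> (\<open>prob_dec_path\<close>), so almost surely every
  state is settled by a finite part of the graph. Hence the limit defining the process exists, and
  every probability is the limit of the corresponding probabilities on finite subgraphs. All exact
  identities are therefore derived on finite graphs, one deterministic configuration at a time, and
  then carried to the limit by dominated convergence.

  Two observations make trees solvable. First, \<open>v\<close> becomes vacant before \<open>s\<close> as soon as some edge
  \<open>e = {v, u}\<close> with \<open>\<tau> e < s\<close> and loser \<open>v\<close> finds \<open>u\<close> occupied: that \<open>v\<close> is itself occupied need not
  be asked, because the earliest such edge finds it occupied. Moreover the state of \<open>u\<close> just before \<open>\<tau> e\<close> does
  not involve \<open>e\<close> (\<open>occ_rec\<close>), so that, given \<open>\<tau> e = r\<close>, it is the state at time \<open>r\<close> in the graph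
  without \<open>e\<close>. Second, as long as \<open>v\<close> is
  occupied, the pieces of the graph glued together at \<open>v\<close> do not influence each other
  (\<open>occ_glue\<close>, \<open>occ_glue_side\<close>). For a root of degree one these facts give
  \<open>\<beta> s = 1 - (1/2) \<integral>\<^sub>0\<^sup>s \<beta>\<^sup>k\<close>, and a vertex of degree \<open>a\<close> is occupied with probability
  \<open>\<beta>\<^sup>a\<close> (\<open>lim_prob_root\<close>); in particular \<open>\<alpha> = \<beta>\<^sup>k\<^sup>+\<^sup>1\<close>.

  For two vertices \<open>v\<close>, \<open>w\<close> at distance \<open>m\<close>, the branches at \<open>v\<close> and \<open>w\<close> away from the path between them,
  \<open>k\<close> at each end, split off as a factor \<open>\<beta>\<^sup>2\<^sup>k\<close>. In the remaining tree, where \<open>v\<close> and \<open>w\<close> are leaves, let \<open>f m\<close> be the probability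
  that both are occupied. If this fails, then one of them was killed first, and at that time
  the other one and the attacking neighbour were both occupied; the latter two are
  the ends of a path of length \<open>m - 1\<close> on one of which \<open>k - 1\<close> further branches are hung. By symmetry
  \<open>f m s = 1 - \<integral>\<^sub>0\<^sup>s \<beta>\<^sup>k\<^sup>-\<^sup>1 f (m - 1)\<close>, while \<open>f 1 s = 1 - s\<close> (\<open>pair_law_holds\<close>).

  In the variable \<open>x = 2 ln \<beta>\<close>, which satisfies \<open>dx = - \<beta>\<^sup>k\<^sup>-\<^sup>1 dt\<close>, the recursion says that the derivative of
  \<open>f m\<close> is \<open>f (m - 1)\<close>, so that \<open>f m\<close> is an explicit combination of exponential series. As
  \<open>\<beta>\<^sup>2 = exp x\<close>, the covariance is \<open>\<beta>\<^sup>2\<^sup>k (f m - exp x)\<close>, which turns the partial sums of these series into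
  tails.
\<close>


section \<open>Deterministic dynamics on finite graphs\<close>

lemma occ_mono:
  assumes "occupied_before F \<tau> \<kappa> s v" "r \<le> s"
  shows "occupied_before F \<tau> \<kappa> r v"
  using assms by (subst (asm) occupied_before.simps, subst occupied_before.simps) (meson less_le_trans)

text \<open>The edge that actually empties \<open>v\<close> also finds \<open>v\<close> occupied. This condition can be dropped, for the
  earliest edge satisfying the remaining conditions finds \<open>v\<close> still occupied.\<close>

lemma occ_iff_others:
  assumes "finite F"
  shows "occupied_before F \<tau> \<kappa> s v \<longleftrightarrow>
    (\<forall>e\<in>F. v \<in> e \<longrightarrow> \<not> (\<tau> e < s \<and> \<kappa> e = v \<and> (\<forall>u\<in>e - {v}. occupied_before F \<tau> \<kappa> (\<tau> e) u)))"
    (is "_ \<longleftrightarrow> (\<forall>e\<in>F. v \<in> e \<longrightarrow> \<not> ?bad e)")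
proof
  assume occ: "occupied_before F \<tau> \<kappa> s v"
  show "\<forall>e\<in>F. v \<in> e \<longrightarrow> \<not> ?bad e"
  proof (rule ccontr)
    assume "\<not> ?thesis"
    \<comment> \<open>The earliest edge that attacks \<open>v\<close> from an occupied neighbour.\<close>
    moreover define S where "S = {e\<in>F. v \<in> e \<and> ?bad e}"
    ultimately have S: "finite S" "S \<noteq> {}" using assms by auto
    define e where "e = arg_min_on \<tau> S"
    have "e \<in> S" and min_S: "\<And>f. f \<in> S \<Longrightarrow> \<tau> e \<le> \<tau> f"
      using arg_min_if_finite[OF S, of \<tau>] by (auto simp: e_def not_less)
    then have e: "e \<in> F" "v \<in> e" "?bad e" by (auto simp: S_def)
    have min: "\<tau> e \<le> \<tau> f" if "f \<in> F" "v \<in> f" "?bad f" for f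
      using min_S that by (auto simp: S_def)
    have "occupied_before F \<tau> \<kappa> (\<tau> e) v"
    proof (rule ccontr)
      assume "\<not> ?thesis"
      then obtain f where "f \<in> F" "v \<in> f" "\<tau> f < \<tau> e" "\<kappa> f = v"
          "\<forall>u\<in>f. occupied_before F \<tau> \<kappa> (\<tau> f) u"
        by (subst (asm) occupied_before.simps) auto
      with min[of f] e(3) show False by force
    qed
    with e(3) have "\<forall>u\<in>e. occupied_before F \<tau> \<kappa> (\<tau> e) u" by blast
    with e assms occ show False
      using occupied_before.simps[of F \<tau> \<kappa> s v] by blast
  qed
next
  assume "\<forall>e\<in>F. v \<in> e \<longrightarrow> \<not> ?bad e"
  then show "occupied_before F \<tau> \<kappa> s v"
    by (subst occupied_before.simps) blast
qed

text \<open>Edges act only after their own time, which is what decouples an edge from the state it finds.\<close>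

lemma occ_delete:
  assumes "finite F" "r \<le> \<tau> e"
  shows "occupied_before F \<tau> \<kappa> r y \<longleftrightarrow> occupied_before (F - {e}) \<tau> \<kappa> r y"
  using assms(2)
proof (induction "card {f\<in>F. \<tau> f < r}" arbitrary: r y rule: less_induct)
  case less
  have IH: "occupied_before F \<tau> \<kappa> (\<tau> f) u \<longleftrightarrow> occupied_before (F - {e}) \<tau> \<kappa> (\<tau> f) u"
    if "f \<in> F" "\<tau> f < r" for f u
    using that assms(1) less(2)
    by (intro less(1) psubset_card_mono) auto
  have eq: "finite F \<and> y \<in> f \<and> \<tau> f < r \<and> \<kappa> f = y \<and> (\<forall>u\<in>f. occupied_before F \<tau> \<kappa> (\<tau> f) u) \<longleftrightarrow>
      f \<noteq> e \<and> finite (F - {e}) \<and> y \<in> f \<and> \<tau> f < r \<and> \<kappa> f = y \<and>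
      (\<forall>u\<in>f. occupied_before (F - {e}) \<tau> \<kappa> (\<tau> f) u)" if "f \<in> F" for f
    using IH[OF that] less(2) assms(1) by (cases "\<tau> f < r") auto
  have "(\<exists>f\<in>F. finite F \<and> y \<in> f \<and> \<tau> f < r \<and> \<kappa> f = y \<and> (\<forall>u\<in>f. occupied_before F \<tau> \<kappa> (\<tau> f) u)) \<longleftrightarrow>
      (\<exists>f\<in>F - {e}. finite (F - {e}) \<and> y \<in> f \<and> \<tau> f < r \<and> \<kappa> f = y \<and>
        (\<forall>u\<in>f. occupied_before (F - {e}) \<tau> \<kappa> (\<tau> f) u))"
    by (simp only: bex_cong[OF refl eq] cong: bex_cong) auto
  then show ?case
    by (subst (1 2) occupied_before.simps) (rule arg_cong[where f=Not])
qed

text \<open>A recursion on the edge set, as opposed to the one on time in the definition. On the right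
  \<open>\<tau> e\<close> and \<open>\<kappa> e\<close> are applied to an event that depends on the other edges only.\<close>

lemma occ_rec:
  assumes "finite F"
  shows "occupied_before F \<tau> \<kappa> s v \<longleftrightarrow>
    (\<forall>e\<in>F. v \<in> e \<longrightarrow>
      \<not> (\<tau> e < s \<and> \<kappa> e = v \<and> (\<forall>u\<in>e - {v}. occupied_before (F - {e}) \<tau> \<kappa> (\<tau> e) u)))"
  using occ_iff_others[OF assms] occ_delete[OF assms order.refl] by simp

lemma occ_cong:
  assumes "\<And>e. e \<in> F \<Longrightarrow> \<tau> e = \<tau>' e" "\<And>e. e \<in> F \<Longrightarrow> \<kappa> e = \<kappa>' e"
  shows "occupied_before F \<tau> \<kappa> s v \<longleftrightarrow> occupied_before F \<tau>' \<kappa>' s v"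
  using assms
proof (induction F \<tau> \<kappa> s v rule: occupied_before.induct)
  case (1 F \<tau> \<kappa> s v)
  then show ?case
    apply (subst (1 2) occupied_before.simps)
    by (intro arg_cong[where f=Not] bex_cong refl) (auto)
qed

text \<open>All influence between the two sides passes through \<open>v\<close>, and a vertex transmits influence only by
  becoming vacant. The disjunction also admits vertices \<open>y\<close> that lie in neither side.\<close>

lemma occ_glue_side:
  assumes fin: "finite F1" "finite F2" and meet: "\<Union>F1 \<inter> \<Union>F2 \<subseteq> {v}"
    and occ: "occupied_before (F1 \<union> F2) \<tau> \<kappa> s v" and "r \<le> s" "y = v \<or> y \<notin> \<Union>F2"
  shows "occupied_before (F1 \<union> F2) \<tau> \<kappa> r y \<longleftrightarrow> occupied_before F1 \<tau> \<kappa> r y"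
  using assms(5,6)
proof (induction "card {f\<in>F1. \<tau> f < r}" arbitrary: r y rule: less_induct)
  case less
  let ?F = "F1 \<union> F2"
  have IH: "occupied_before ?F \<tau> \<kappa> (\<tau> f) u \<longleftrightarrow> occupied_before F1 \<tau> \<kappa> (\<tau> f) u"
    if "f \<in> F1" "\<tau> f < r" "u \<in> f" for f u
    using that fin(1) less(2) meet
    by (intro less(1) psubset_card_mono) auto
  have "\<not> (\<tau> e < r \<and> \<kappa> e = y \<and> (\<forall>u\<in>e. occupied_before ?F \<tau> \<kappa> (\<tau> e) u))"
    if "e \<in> F2" "e \<notin> F1" "y \<in> e" for e
  proof
    assume *: "\<tau> e < r \<and> \<kappa> e = y \<and> (\<forall>u\<in>e. occupied_before ?F \<tau> \<kappa> (\<tau> e) u)"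
    have "y = v" using that less(3) meet by auto
    with * that occ \<open>r \<le> s\<close> fin show False
      by (subst (asm) (2) occupied_before.simps) auto
  qed
  then show ?case
    apply (subst (1 2) occupied_before.simps)
    using IH fin by blast
qed

text \<open>If \<open>v\<close> is vacant in the union, look at the edge that killed it: until then \<open>v\<close> was occupied, so
  that edge found on its own side the same states as in the union.\<close>

lemma occ_glue:
  assumes fin: "finite F1" "finite F2" and meet: "\<Union>F1 \<inter> \<Union>F2 \<subseteq> {v}"
  shows "occupied_before (F1 \<union> F2) \<tau> \<kappa> s v \<longleftrightarrow>
    occupied_before F1 \<tau> \<kappa> s v \<and> occupied_before F2 \<tau> \<kappa> s v"
proof
  assume "occupied_before (F1 \<union> F2) \<tau> \<kappa> s v"
  with occ_glue_side[OF fin meet this order.refl] occ_glue_side[OF fin(2,1), of v \<tau> \<kappa> s s v] meet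
  show "occupied_before F1 \<tau> \<kappa> s v \<and> occupied_before F2 \<tau> \<kappa> s v"
    by (auto simp: Un_commute Int_commute)
next
  assume *: "occupied_before F1 \<tau> \<kappa> s v \<and> occupied_before F2 \<tau> \<kappa> s v"
  show "occupied_before (F1 \<union> F2) \<tau> \<kappa> s v"
  proof (rule ccontr)
    assume "\<not> ?thesis"
    then obtain e where e: "e \<in> F1 \<union> F2" "v \<in> e" "\<tau> e < s" "\<kappa> e = v"
        "\<forall>u\<in>e. occupied_before (F1 \<union> F2) \<tau> \<kappa> (\<tau> e) u"
      by (subst (asm) occupied_before.simps) auto
    have ov: "occupied_before (F1 \<union> F2) \<tau> \<kappa> (\<tau> e) v" using e by auto
    from e(1) show False
    proof
      assume "e \<in> F1"
      have "u = v \<or> u \<notin> \<Union>F2" if "u \<in> e" for u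
        using meet \<open>e \<in> F1\<close> that by auto
      then have "\<forall>u\<in>e. occupied_before F1 \<tau> \<kappa> (\<tau> e) u"
        using occ_glue_side[OF fin meet ov order.refl] e(5) by blast
      with * e \<open>e \<in> F1\<close> fin show False
        using occupied_before.simps[of F1 \<tau> \<kappa> s v] by blast
    next
      assume "e \<in> F2"
      have "u = v \<or> u \<notin> \<Union>F1" if "u \<in> e" for u
        using meet \<open>e \<in> F2\<close> that by auto
      moreover have "\<Union>F2 \<inter> \<Union>F1 \<subseteq> {v}" using meet by auto
      ultimately have "\<forall>u\<in>e. occupied_before F2 \<tau> \<kappa> (\<tau> e) u"
        using occ_glue_side[OF fin(2,1) _ _ order.refl, of v \<tau> \<kappa> "\<tau> e"] ov e(5)
        by (simp add: Un_commute)
      with * e \<open>e \<in> F2\<close> fin show False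
        using occupied_before.simps[of F2 \<tau> \<kappa> s v] by blast
    qed
  qed
qed

text \<open>A chain of \<open>d\<close> edges from \<open>v\<close> whose clocks decrease, starting below \<open>s\<close>. Each edge is removed
  after use, as in \<open>occ_rec\<close>; this makes the rest of the chain independent of its first edge.\<close>

fun dec_path :: "nat \<Rightarrow> 'a set set \<Rightarrow> ('a set \<Rightarrow> real) \<Rightarrow> real \<Rightarrow> 'a \<Rightarrow> bool" where
  "dec_path 0 F \<tau> s v \<longleftrightarrow> True"
| "dec_path (Suc d) F \<tau> s v \<longleftrightarrow>
     (\<exists>e\<in>F. v \<in> e \<and> \<tau> e < s \<and> (\<exists>u\<in>e - {v}. dec_path d (F - {e}) \<tau> (\<tau> e) u))"

text \<open>Unfolding \<open>occ_rec\<close> traces a chain of decreasing clocks. If all these chains are shorter than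
  \<open>d\<close>, the unfolding stops within distance \<open>d\<close> of \<open>v\<close>, in a part of the graph that is finite by local finiteness
  and hence eventually contained in \<open>G n\<close>.\<close>

lemma occ_eventually_constant:
  fixes G :: "nat \<Rightarrow> 'a set set"
  assumes "\<And>n. finite (G n)"
    and "\<And>e. e \<in> E \<Longrightarrow> e \<noteq> {} \<Longrightarrow> eventually (\<lambda>n. e \<in> G n) sequentially"
    and "\<And>v. finite {e\<in>E. v \<in> e}" "\<And>e. e \<in> E \<Longrightarrow> finite e"
  shows "F \<subseteq> E \<Longrightarrow> \<not> dec_path d F \<tau> s v \<Longrightarrow>
    \<exists>b. eventually (\<lambda>n. occupied_before (F \<inter> G n) \<tau> \<kappa> s v = b) sequentially"
proof (induction d arbitrary: F s v)
  case (Suc d)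
  have "\<exists>b. eventually (\<lambda>n. occupied_before ((F - {e}) \<inter> G n) \<tau> \<kappa> (\<tau> e) u = b) sequentially"
    if "e \<in> F" "v \<in> e" "\<tau> e < s" "u \<in> e - {v}" for e u
    using that Suc.prems by (intro Suc.IH) auto
  then obtain b where b: "\<And>e u. e \<in> F \<Longrightarrow> v \<in> e \<Longrightarrow> \<tau> e < s \<Longrightarrow> u \<in> e - {v} \<Longrightarrow>
      eventually (\<lambda>n. occupied_before ((F - {e}) \<inter> G n) \<tau> \<kappa> (\<tau> e) u = b e u) sequentially"
    by metis
  define A where "A = {e\<in>F. v \<in> e \<and> \<tau> e < s}"
  have finA: "finite A" 
    using assms(3)[of v] Suc.prems(1) by (rule_tac finite_subset) (auto simp: A_def)
  have "eventually (\<lambda>n. \<forall>e\<in>A. e \<in> G n \<and>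
      (\<forall>u\<in>e - {v}. occupied_before ((F - {e}) \<inter> G n) \<tau> \<kappa> (\<tau> e) u = b e u)) sequentially"
    using assms(2,4) Suc.prems(1) b
    by (intro eventually_ball_finite[OF finA] ballI eventually_conj eventually_ball_finite)
       (auto simp: A_def)
  then have "eventually (\<lambda>n. occupied_before (F \<inter> G n) \<tau> \<kappa> s v =
      (\<forall>e\<in>A. \<not> (\<kappa> e = v \<and> (\<forall>u\<in>e - {v}. b e u)))) sequentially"
  proof eventually_elim
    case (elim n)
    have "F \<inter> G n - {e} = (F - {e}) \<inter> G n" for e by auto
    then show ?case
      using elim assms(1) by (subst occ_rec) (auto simp: A_def)
  qed
  then show ?case by blast
qed simp

lemma occupied_at_eq_before:
  assumes "finite F" "\<And>e. e \<in> F \<Longrightarrow> \<tau> e \<noteq> t"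
  shows "occupied_at F \<tau> \<kappa> t v \<longleftrightarrow> occupied_before F \<tau> \<kappa> t v"
proof -
  have "(\<exists>e\<in>F. v \<in> e \<and> \<tau> e \<le> t \<and> \<kappa> e = v \<and> (\<forall>u\<in>e. occupied_before F \<tau> \<kappa> (\<tau> e) u)) \<longleftrightarrow>
    (\<exists>e\<in>F. finite F \<and> v \<in> e \<and> \<tau> e < t \<and> \<kappa> e = v \<and> (\<forall>u\<in>e. occupied_before F \<tau> \<kappa> (\<tau> e) u))"
    using assms by (intro bex_cong refl) (auto simp: less_le)
  then show ?thesis
    unfolding occupied_at_def by (subst occupied_before.simps) (rule arg_cong[where f=Not])
qed

section \<open>Independence of the edge marks\<close>

abbreviation edge_space :: "'a set \<Rightarrow> (real \<times> 'a) measure" where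
  "edge_space e \<equiv> borel \<Otimes>\<^sub>M count_space e"

text \<open>Measurability is proved jointly in time and configuration because \<open>occ_rec\<close> evaluates states at
  the random times \<open>\<tau> e\<close>.\<close>

lemma pred_occ:
  assumes "finite F" "F \<subseteq> K" "\<And>e. e \<in> F \<Longrightarrow> finite e"
  shows "Measurable.pred (borel \<Otimes>\<^sub>M PiM K edge_space)
    (\<lambda>p. occupied_before F (\<lambda>e. fst (snd p e)) (\<lambda>e. snd (snd p e)) (fst p) v)"
  using assms
proof (induction "card F" arbitrary: F v rule: less_induct)
  case less
  have IH: "Measurable.pred (borel \<Otimes>\<^sub>M PiM K edge_space)
      (\<lambda>p. occupied_before (F - {e}) (\<lambda>e. fst (snd p e)) (\<lambda>e. snd (snd p e)) (fst p) u)"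
    if "e \<in> F" for e u
  proof (rule less.hyps)
    show "card (F - {e}) < card F" using that less.prems(1) by (rule card_Diff1_less[rotated])
  qed (use less.prems in auto)
  have comp: "(\<lambda>p. snd p e) \<in> borel \<Otimes>\<^sub>M PiM K edge_space \<rightarrow>\<^sub>M edge_space e" if "e \<in> F" for e
  proof -
    have "e \<in> K" using that less.prems by auto
    then show ?thesis by measurable
  qed
  have shift: "(\<lambda>p. (fst (snd p e), snd p)) \<in> borel \<Otimes>\<^sub>M PiM K edge_space \<rightarrow>\<^sub>M borel \<Otimes>\<^sub>M PiM K edge_space"
    if "e \<in> F" for e
    using comp[OF that] by measurable
  have IH': "Measurable.pred (borel \<Otimes>\<^sub>M PiM K edge_space)
      (\<lambda>p. occupied_before (F - {e}) (\<lambda>e. fst (snd p e)) (\<lambda>e. snd (snd p e)) (fst (snd p e)) u)"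
    if "e \<in> F" for e u
    using measurable_compose[OF shift[OF that] IH[OF that]] by simp
  have time: "Measurable.pred (borel \<Otimes>\<^sub>M PiM K edge_space) (\<lambda>p. fst (snd p e) < fst p)" if "e \<in> F" for e
    using comp[OF that] by measurable
  have loser: "Measurable.pred (borel \<Otimes>\<^sub>M PiM K edge_space) (\<lambda>p. snd (snd p e) = v)" if "e \<in> F" for e
    using measurable_compose[OF measurable_compose[OF comp[OF that] measurable_snd],
      of "\<lambda>x. x = v" "count_space UNIV"] by simp
  show ?case
    unfolding occ_rec[OF less.prems(1)]
  proof (intro pred_intros_finite(3) pred_intros_logic)
    show "finite F" by fact
  qed (use time loser IH' less.prems in \<open>auto intro!: pred_intros_finite(3) pred_intros_logic\<close>)
qed

lemma pred_dec_path:
  assumes "F \<subseteq> K" "\<And>e. e \<in> F \<Longrightarrow> finite e" "\<And>v. finite {e\<in>F. v \<in> e}"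
  shows "Measurable.pred (borel \<Otimes>\<^sub>M PiM K edge_space)
    (\<lambda>p. dec_path d F (\<lambda>e. fst (snd p e)) (fst p) v)"
  using assms
proof (induction d arbitrary: F v)
  case (Suc d)
  have comp: "(\<lambda>p. snd p e) \<in> borel \<Otimes>\<^sub>M PiM K edge_space \<rightarrow>\<^sub>M edge_space e" if "e \<in> F" for e
  proof -
    have "e \<in> K" using that Suc.prems by auto
    then show ?thesis by measurable
  qed
  have shift: "(\<lambda>p. (fst (snd p e), snd p)) \<in> borel \<Otimes>\<^sub>M PiM K edge_space \<rightarrow>\<^sub>M borel \<Otimes>\<^sub>M PiM K edge_space"
    if "e \<in> F" for e
    using comp[OF that] by measurable
  have "Measurable.pred (borel \<Otimes>\<^sub>M PiM K edge_space)
      (\<lambda>p. dec_path d (F - {e}) (\<lambda>e. fst (snd p e)) (fst p) u)" if "e \<in> F" for e u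
    using Suc.prems by (intro Suc.IH) (auto intro: rev_finite_subset)
  from measurable_compose[OF shift this]
  have IH': "Measurable.pred (borel \<Otimes>\<^sub>M PiM K edge_space)
      (\<lambda>p. dec_path d (F - {e}) (\<lambda>e. fst (snd p e)) (fst (snd p e)) u)" if "e \<in> F" for e u
    using that by simp
  have time: "Measurable.pred (borel \<Otimes>\<^sub>M PiM K edge_space) (\<lambda>p. fst (snd p e) < fst p)" if "e \<in> F" for e
    using comp[OF that] by measurable
  have eq: "dec_path (Suc d) F t s v \<longleftrightarrow> (\<exists>e\<in>{e\<in>F. v \<in> e}.
      t e < s \<and> (\<exists>u\<in>e - {v}. dec_path d (F - {e}) t (t e) u))" for t s
    by auto
  show ?case
    unfolding eq using Suc.prems
    by (intro pred_intros_finite(4) pred_intros_logic time IH') auto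
qed simp

locale pair_annihilation = annihilation M E \<tau> \<kappa>
  for M :: "'\<omega> measure" and E :: "'a set set" and \<tau> \<kappa> +
  assumes card_edge: "e \<in> E \<Longrightarrow> card e = 2"
begin

definition occ :: "'a set set \<Rightarrow> real \<Rightarrow> 'a \<Rightarrow> '\<omega> \<Rightarrow> bool" where
  "occ F s v \<omega> = occupied_before F (\<lambda>e. \<tau> e \<omega>) (\<lambda>e. \<kappa> e \<omega>) s v"

definition occ_prob :: "'a set set \<Rightarrow> real \<Rightarrow> 'a set \<Rightarrow> real" where
  "occ_prob F s S = prob {\<omega>\<in>space M. \<forall>x\<in>S. occ F s x \<omega>}"

text \<open>Restricting to \<open>F\<close> makes events that depend on the edges in \<open>F\<close> events of the product space over
  \<open>F\<close>, where independence of disjoint edge sets is available.\<close>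

definition marks :: "'a set set \<Rightarrow> '\<omega> \<Rightarrow> 'a set \<Rightarrow> real \<times> 'a" where
  "marks F \<omega> = restrict (\<lambda>e. (\<tau> e \<omega>, \<kappa> e \<omega>)) F"

lemma finite_edge: "e \<in> E \<Longrightarrow> finite e"
  using card_edge by (metis card.infinite zero_neq_numeral)

lemma edge_measurable: "e \<in> E \<Longrightarrow> (\<lambda>\<omega>. (\<tau> e \<omega>, \<kappa> e \<omega>)) \<in> M \<rightarrow>\<^sub>M edge_space e"
  using indep_edges unfolding indep_vars_def2 by auto

lemma marks_measurable: "F \<subseteq> E \<Longrightarrow> marks F \<in> M \<rightarrow>\<^sub>M PiM F edge_space"
  unfolding marks_def by (rule measurable_restrict) (use edge_measurable in auto)

lemma \<tau>_measurable: "e \<in> E \<Longrightarrow> \<tau> e \<in> borel_measurable M"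
  using measurable_compose[OF edge_measurable measurable_fst, of e] by simp

lemma \<kappa>_in: "e \<in> E \<Longrightarrow> \<omega> \<in> space M \<Longrightarrow> \<kappa> e \<omega> \<in> e"
  using measurable_space[OF edge_measurable, of e \<omega>] by (auto simp: space_pair_measure)

lemma occ_marks:
  "F \<subseteq> K \<Longrightarrow> occ F s v \<omega> = occupied_before F (\<lambda>e. fst (marks K \<omega> e)) (\<lambda>e. snd (marks K \<omega> e)) s v"
  unfolding occ_def marks_def by (rule occ_cong) auto

lemma pred_occ_marks:
  assumes "finite F" "F \<subseteq> E" "h \<in> borel_measurable M"
  shows "Measurable.pred M (\<lambda>\<omega>. occ F (h \<omega>) v \<omega>)"
proof -
  have "(\<lambda>\<omega>. (h \<omega>, marks F \<omega>)) \<in> M \<rightarrow>\<^sub>M borel \<Otimes>\<^sub>M PiM F edge_space"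
    using marks_measurable[OF assms(2)] assms(3) by measurable
  from measurable_compose[OF this pred_occ[OF assms(1) order.refl, of v]]
  show ?thesis
    using occ_marks[OF order.refl, of F] finite_edge assms(2) by (simp add: subset_iff)
qed

lemma indep_marks:
  assumes "F \<subseteq> E" "G \<subseteq> E" "F \<inter> G = {}"
    "Measurable.pred (PiM F edge_space) P" "Measurable.pred (PiM G edge_space) Q"
  shows "prob {\<omega>\<in>space M. P (marks F \<omega>) \<and> Q (marks G \<omega>)} =
    prob {\<omega>\<in>space M. P (marks F \<omega>)} * prob {\<omega>\<in>space M. Q (marks G \<omega>)}"
proof -
  have "indep_var (PiM F edge_space) (marks F) (PiM G edge_space) (marks G)"
    using indep_var_restrict[OF indep_edges assms(3,1,2)] by (simp add: marks_def[abs_def])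
  from indep_varD[OF this, of "{z\<in>space (PiM F edge_space). P z}" "{z\<in>space (PiM G edge_space). Q z}"]
  have "prob ((\<lambda>x. (marks F x, marks G x)) -`
      ({z\<in>space (PiM F edge_space). P z} \<times> {z\<in>space (PiM G edge_space). Q z}) \<inter> space M) =
    prob (marks F -` {z\<in>space (PiM F edge_space). P z} \<inter> space M) *
    prob (marks G -` {z\<in>space (PiM G edge_space). Q z} \<inter> space M)"
    using assms(4,5) by (simp add: pred_def)
  moreover have "marks F \<omega> \<in> space (PiM F edge_space)" "marks G \<omega> \<in> space (PiM G edge_space)"
    if "\<omega> \<in> space M" for \<omega>
    using that measurable_space[OF marks_measurable] assms by auto
  ultimately show ?thesis
    by (auto simp: vimage_def Int_def conj_commute cong: conj_cong intro!: arg_cong2[where f="(*)"] )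
qed

text \<open>Condition on the clock of \<open>e\<close>: it is uniform and independent of the other edges, and the loser is
  \<open>c\<close> with probability \<open>1/2\<close>. This is the source of all integral equations below.\<close>

lemma prob_edge_marks:
  assumes e: "e \<in> E" "c \<in> e" and F: "F \<subseteq> E" "e \<notin> F" and t: "0 \<le> t" "t \<le> 1"
    and Q[measurable]: "Measurable.pred (borel \<Otimes>\<^sub>M PiM F edge_space) (\<lambda>p. Q (fst p) (snd p))"
  shows "prob {\<omega>\<in>space M. \<tau> e \<omega> < t \<and> \<kappa> e \<omega> = c \<and> Q (\<tau> e \<omega>) (marks F \<omega>)} =
    (LINT r:{0..t}|lborel. prob {\<omega>\<in>space M. Q r (marks F \<omega>)}) / 2"
proof -
  define U where "U = uniform_measure lborel {0<..<1::real}"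
  define C where "C = uniform_count_measure e"
  define N where "N = distr M (PiM F edge_space) (marks F)"
  have mF[measurable]: "marks F \<in> M \<rightarrow>\<^sub>M PiM F edge_space" by (rule marks_measurable) fact
  have me[measurable]: "(\<lambda>\<omega>. (\<tau> e \<omega>, \<kappa> e \<omega>)) \<in> M \<rightarrow>\<^sub>M edge_space e"
    by (rule edge_measurable) fact
  interpret N: prob_space N unfolding N_def by (rule prob_space_distr) fact
  interpret U: prob_space U unfolding U_def by (rule prob_space_uniform_measure) auto
  interpret C: prob_space C unfolding C_def
    using e finite_edge by (intro prob_space_uniform_count_measure) auto
  have sU[measurable_cong]: "sets U = sets borel" by (simp add: U_def)
  have sC[measurable_cong]: "sets C = sets (count_space e)" by (simp add: C_def sets_uniform_count_measure)
  have sN[measurable_cong]: "sets N = sets (PiM F edge_space)" by (simp add: N_def)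
  have spC: "space C = e" by (simp add: C_def space_uniform_count_measure)
  have spN: "space N = space (PiM F edge_space)" by (simp add: N_def)
  \<comment> \<open>\<open>indep_var\<close> relates variables with values in one type, so the mark of \<open>e\<close> is first taken as a
    configuration on \<open>{e}\<close> and its coordinate is extracted afterwards.\<close>
  have "indep_var (PiM {e} edge_space) (marks {e}) (PiM F edge_space) (marks F)"
    using indep_var_restrict[OF indep_edges, of "{e}" F] F e by (simp add: marks_def[abs_def])
  then have joint: "distr M (PiM {e} edge_space) (marks {e}) \<Otimes>\<^sub>M N =
      distr M (PiM {e} edge_space \<Otimes>\<^sub>M PiM F edge_space) (\<lambda>\<omega>. (marks {e} \<omega>, marks F \<omega>))"
    by (simp add: indep_var_distribution_eq N_def)
  have m1[measurable]: "marks {e} \<in> M \<rightarrow>\<^sub>M PiM {e} edge_space" by (rule marks_measurable) (use e in auto)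
  have coord: "(\<lambda>z. z e) \<in> PiM {e} edge_space \<rightarrow>\<^sub>M edge_space e" by measurable
  have "U \<Otimes>\<^sub>M C = distr (distr M (PiM {e} edge_space) (marks {e})) (edge_space e) (\<lambda>z. z e)"
    using law_edge[OF e(1)] by (simp add: U_def C_def distr_distr comp_def marks_def)
  then have "(U \<Otimes>\<^sub>M C) \<Otimes>\<^sub>M N =
      distr (distr M (PiM {e} edge_space) (marks {e})) (edge_space e) (\<lambda>z. z e) \<Otimes>\<^sub>M
      distr N (PiM F edge_space) (\<lambda>z. z)"
    by (simp add: N_def distr_distr comp_def)
  also have "\<dots> = distr (distr M (PiM {e} edge_space) (marks {e}) \<Otimes>\<^sub>M N)
      (edge_space e \<Otimes>\<^sub>M PiM F edge_space) (\<lambda>(x, z). (x e, z))"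
  proof (rule pair_measure_distr)
    show "sigma_finite_measure (distr N (PiM F edge_space) (\<lambda>z. z))"
      using N.sigma_finite_measure_axioms by (simp add: N_def distr_distr comp_def)
  qed (use coord in auto)
  also have "\<dots> = distr M (edge_space e \<Otimes>\<^sub>M PiM F edge_space) (\<lambda>\<omega>. ((\<tau> e \<omega>, \<kappa> e \<omega>), marks F \<omega>))"
  proof -
    have "(\<lambda>(x, z). (x e, z)) \<circ> (\<lambda>\<omega>. (marks {e} \<omega>, marks F \<omega>)) = (\<lambda>\<omega>. ((\<tau> e \<omega>, \<kappa> e \<omega>), marks F \<omega>))"
      by (auto simp: marks_def)
    then show ?thesis
      unfolding joint using coord by (subst distr_distr) auto
  qed
  finally have D: "distr M (edge_space e \<Otimes>\<^sub>M PiM F edge_space) (\<lambda>\<omega>. ((\<tau> e \<omega>, \<kappa> e \<omega>), marks F \<omega>)) =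
      (U \<Otimes>\<^sub>M C) \<Otimes>\<^sub>M N" ..
  define g where "g r = prob {\<omega>\<in>space M. Q r (marks F \<omega>)}" for r
  have Qr[measurable]: "Measurable.pred (PiM F edge_space) (Q r)" for r
    using measurable_compose[OF _ Q, of "\<lambda>z. (r, z)" "PiM F edge_space"] by simp
  have gN: "emeasure N {z\<in>space N. Q r z} = ennreal (g r)" for r
  proof -
    have "emeasure N {z\<in>space N. Q r z} = emeasure M (marks F -` {z\<in>space N. Q r z} \<inter> space M)"
      unfolding N_def by (subst emeasure_distr) (auto)
    also have "marks F -` {z\<in>space N. Q r z} \<inter> space M = {\<omega>\<in>space M. Q r (marks F \<omega>)}"
      using measurable_space[OF mF] by (auto simp: spN)
    finally show ?thesis by (simp add: g_def emeasure_eq_measure)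
  qed
  have gm[measurable]: "g \<in> borel_measurable borel"
  proof -
    have "(\<lambda>r. emeasure N (Pair r -` {p\<in>space (borel \<Otimes>\<^sub>M N). Q (fst p) (snd p)})) \<in> borel_measurable borel"
      by (rule N.measurable_emeasure_Pair) measurable
    then have "(\<lambda>r. enn2real (emeasure N {z\<in>space N. Q r z})) \<in> borel_measurable borel"
      by (auto simp: space_pair_measure vimage_def)
    then show ?thesis unfolding gN by (simp add: g_def[abs_def])
  qed
  have g01: "0 \<le> g r" "g r \<le> 1" for r by (auto simp: g_def)
  define A where "A = {p\<in>space ((U \<Otimes>\<^sub>M C) \<Otimes>\<^sub>M N).
      fst (fst p) < t \<and> snd (fst p) = c \<and> Q (fst (fst p)) (snd p)}"
  have A[measurable]: "A \<in> sets ((U \<Otimes>\<^sub>M C) \<Otimes>\<^sub>M N)"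
  proof -
    have 1: "Measurable.pred ((U \<Otimes>\<^sub>M C) \<Otimes>\<^sub>M N) (\<lambda>p. fst (fst p) < t)"
      by measurable
    have 2: "Measurable.pred ((U \<Otimes>\<^sub>M C) \<Otimes>\<^sub>M N) (\<lambda>p. snd (fst p) = c)"
    proof -
      have "(\<lambda>p. snd (fst p)) \<in> ((U \<Otimes>\<^sub>M C) \<Otimes>\<^sub>M N) \<rightarrow>\<^sub>M count_space e" by measurable
      from measurable_compose[OF this, of "\<lambda>x. x = c" "count_space UNIV"] show ?thesis by simp
    qed
    have 3: "Measurable.pred ((U \<Otimes>\<^sub>M C) \<Otimes>\<^sub>M N) (\<lambda>p. Q (fst (fst p)) (snd p))"
      using measurable_compose[OF _ Q, of "\<lambda>p. (fst (fst p), snd p)" "(U \<Otimes>\<^sub>M C) \<Otimes>\<^sub>M N"] by simp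
    show ?thesis unfolding A_def by (intro predE pred_intros_logic 1 2 3)
  qed
  have sets_eq: "sets ((U \<Otimes>\<^sub>M C) \<Otimes>\<^sub>M N) = sets (edge_space e \<Otimes>\<^sub>M PiM F edge_space)"
    by (intro sets_pair_measure_cong sU sC sN)
  have "emeasure M {\<omega>\<in>space M. \<tau> e \<omega> < t \<and> \<kappa> e \<omega> = c \<and> Q (\<tau> e \<omega>) (marks F \<omega>)} =
      emeasure M ((\<lambda>\<omega>. ((\<tau> e \<omega>, \<kappa> e \<omega>), marks F \<omega>)) -` A \<inter> space M)"
    using measurable_space[OF mF] measurable_space[OF me]
    by (intro arg_cong[where f="emeasure M"])
       (auto simp: A_def space_pair_measure spN spC U_def)
  also have "\<dots> = emeasure ((U \<Otimes>\<^sub>M C) \<Otimes>\<^sub>M N) A"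
    using A unfolding D[symmetric] by (subst emeasure_distr) (auto simp: sets_eq)
  also have "\<dots> = (\<integral>\<^sup>+ x. emeasure N (Pair x -` A) \<partial>(U \<Otimes>\<^sub>M C))"
    by (rule N.emeasure_pair_measure_alt) fact
  also have "\<dots> = (\<integral>\<^sup>+ x. (indicator {..<t} (fst x) * ennreal (g (fst x))) * indicator {c} (snd x) \<partial>(U \<Otimes>\<^sub>M C))"
  proof (rule nn_integral_cong)
    fix x assume x: "x \<in> space (U \<Otimes>\<^sub>M C)"
    then have "Pair x -` A = (if fst x < t \<and> snd x = c then {z\<in>space N. Q (fst x) z} else {})"
      by (auto simp: A_def space_pair_measure)
    then show "emeasure N (Pair x -` A) = indicator {..<t} (fst x) * ennreal (g (fst x)) * indicator {c} (snd x)"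
      by (auto simp: gN)
  qed
  also have "\<dots> = (\<integral>\<^sup>+ r. \<integral>\<^sup>+ y. (indicator {..<t} r * ennreal (g r)) * indicator {c} y \<partial>C \<partial>U)"
  proof (subst C.nn_integral_fst[symmetric])
    have c: "{c} \<in> sets C" using e by (simp add: sC)
    show "(\<lambda>x. indicator {..<t} (fst x) * ennreal (g (fst x)) * indicator {c} (snd x)) \<in> borel_measurable (U \<Otimes>\<^sub>M C)"
    proof (intro borel_measurable_times_ennreal)
      have "(\<lambda>x. fst x) \<in> U \<Otimes>\<^sub>M C \<rightarrow>\<^sub>M borel" by measurable
      then show "(\<lambda>x. ennreal (g (fst x))) \<in> borel_measurable (U \<Otimes>\<^sub>M C)"
        "(\<lambda>x. indicator {..<t} (fst x) :: ennreal) \<in> borel_measurable (U \<Otimes>\<^sub>M C)"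
        by (rule measurable_compose; measurable)+
      show "(\<lambda>x. indicator {c} (snd x) :: ennreal) \<in> borel_measurable (U \<Otimes>\<^sub>M C)"
        using c by (intro measurable_compose[OF measurable_snd]) auto
    qed
  qed simp
  also have "\<dots> = (\<integral>\<^sup>+ r. (indicator {..<t} r * ennreal (g r)) * ennreal (1 / 2) \<partial>U)"
  proof (rule nn_integral_cong)
    fix r
    have "emeasure C {c} = ennreal (1 / 2)"
      using e finite_edge[OF e(1)] card_edge[OF e(1)]
      by (simp add: C_def emeasure_uniform_count_measure)
    moreover have "{c} \<in> sets C" using e by (simp add: sC)
    ultimately show "(\<integral>\<^sup>+ y. (indicator {..<t} r * ennreal (g r)) * indicator {c} y \<partial>C) =
        (indicator {..<t} r * ennreal (g r)) * ennreal (1 / 2)"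
      by (simp add: nn_integral_cmult_indicator)
  qed
  also have "\<dots> = (\<integral>\<^sup>+ r. (indicator {..<t} r * ennreal (g r)) * ennreal (1 / 2) * indicator {0<..<1} r \<partial>lborel)"
    unfolding U_def by (subst nn_integral_uniform_measure) (auto simp: divide_ennreal_def)
  also have "\<dots> = (\<integral>\<^sup>+ r. ennreal (indicator {0..t} r * g r / 2) \<partial>lborel)"
  proof (rule nn_integral_cong_AE)
    have "AE r in lborel. r \<noteq> (0::real)" "AE r in lborel. r \<noteq> t"
      by (auto simp: AE_lborel_singleton)
    then show "AE r in lborel. (indicator {..<t} r * ennreal (g r)) * ennreal (1 / 2) * indicator {0<..<1} r =
        ennreal (indicator {0..t} r * g r / 2)"
      by eventually_elim
        (use t g01 in \<open>auto simp: indicator_def ennreal_mult[symmetric] not_less simp del: ennreal_half\<close>)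
  qed
  also have "\<dots> = ennreal (LINT r|lborel. indicator {0..t} r * g r / 2)"
  proof (rule nn_integral_eq_integral)
    have "integrable lborel (\<lambda>r. indicator {0..t} r *\<^sub>R (g r / 2))"
    proof (rule integrableI_bounded_set_indicator[where B=1])
      show "AE x in lborel. x \<in> {0..t} \<longrightarrow> norm (g x / 2) \<le> 1"
        using g01 by (auto intro!: AE_I2 simp: abs_le_iff) (smt (verit) g01 field_sum_of_halves)+
    qed (use t in auto)
    then show "integrable lborel (\<lambda>r. indicator {0..t} r * g r / 2)" by simp
  qed (use g01 in auto)
  finally have "prob {\<omega>\<in>space M. \<tau> e \<omega> < t \<and> \<kappa> e \<omega> = c \<and> Q (\<tau> e \<omega>) (marks F \<omega>)} =
      (LINT r|lborel. indicator {0..t} r * g r / 2)"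
    by (subst (asm) emeasure_eq_measure, subst (asm) ennreal_inj) (auto intro!: integral_nonneg_AE simp: g01)
  also have "\<dots> = (LINT r:{0..t}|lborel. g r) / 2"
    by (simp add: set_lebesgue_integral_def)
  finally show ?thesis unfolding g_def .
qed

end

section \<open>Decreasing chains of clocks are short\<close>

lemma dec_path_mono: "dec_path d F \<tau> r v \<Longrightarrow> r \<le> s \<Longrightarrow> dec_path d F \<tau> s v"
  by (cases d) force+

lemma dec_path_cong:
  "(\<And>e. e \<in> F \<Longrightarrow> \<tau> e = \<tau>' e) \<Longrightarrow> dec_path d F \<tau> s v \<longleftrightarrow> dec_path d F \<tau>' s v"
proof (induction d arbitrary: F s v)
  case (Suc d)
  have "dec_path d (F - {e}) \<tau> (\<tau> e) u \<longleftrightarrow> dec_path d (F - {e}) \<tau>' (\<tau>' e) u" if "e \<in> F" for e u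
    using Suc.IH[of "F - {e}"] Suc.prems that by auto
  then show ?case
    using Suc.prems by auto
qed simp

lemma set_integrable_unit:
  fixes g :: "real \<Rightarrow> real"
  assumes "g \<in> borel_measurable borel" "\<And>r. 0 \<le> g r" "\<And>r. g r \<le> 1"
  shows "set_integrable lborel {0..t} g"
  unfolding set_integrable_def
proof (rule integrableI_bounded_set_indicator[where B=1])
  show "AE x in lborel. x \<in> {0..t} \<longrightarrow> norm (g x) \<le> 1"
    using assms by (auto intro!: AE_I2)
  show "emeasure lborel {0..t} < \<infinity>" by (cases "0 \<le> t") auto
qed (use assms in auto)

lemma LINT_power_over_fact:
  assumes "0 \<le> (s::real)"
  shows "set_integrable lborel {0..s} (\<lambda>r. (c * r) ^ d / fact d)"
    and "c * (LINT r:{0..s}|lborel. (c * r) ^ d / fact d) = (c * s) ^ Suc d / fact (Suc d)"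
proof -
  show "set_integrable lborel {0..s} (\<lambda>r. (c * r) ^ d / fact d)"
    by (intro borel_integrable_atLeastAtMost' continuous_intros) auto
  have "(LINT r:{0..s}|lborel. (c * r) ^ d / fact d) = (\<integral>r. (c ^ d / fact d) * (r ^ d * indicator {0..s} r) \<partial>lborel)"
    unfolding set_lebesgue_integral_def by (intro Bochner_Integration.integral_cong) (auto simp: power_mult_distrib)
  also have "\<dots> = (c ^ d / fact d) * (s ^ Suc d / Suc d)"
    using assms by (subst Bochner_Integration.integral_mult_right_zero, subst integral_power) auto
  finally show "c * (LINT r:{0..s}|lborel. (c * r) ^ d / fact d) = (c * s) ^ Suc d / fact (Suc d)"
    by (simp add: power_mult_distrib fact_Suc mult_ac del: of_nat_Suc)
qed

context pair_annihilation
begin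

lemma pred_occ_const: "finite F \<Longrightarrow> F \<subseteq> E \<Longrightarrow> Measurable.pred M (occ F s v)"
  using pred_occ_marks[of F "\<lambda>_. s" v] by simp

lemma occ_prob_mono:
  assumes "finite F" "F \<subseteq> E" "finite S" "r \<le> s"
  shows "occ_prob F s S \<le> occ_prob F r S"
  unfolding occ_prob_def
proof (rule finite_measure_mono)
  show "{\<omega> \<in> space M. \<forall>x\<in>S. occ F s x \<omega>} \<subseteq> {\<omega> \<in> space M. \<forall>x\<in>S. occ F r x \<omega>}"
    by (auto simp: occ_def intro: occ_mono[OF _ assms(4)])
  show "{\<omega> \<in> space M. \<forall>x\<in>S. occ F r x \<omega>} \<in> events"
    using assms by (intro predE pred_intros_finite(3) pred_occ_const) auto
qed

lemma occ_prob_measurable: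
  assumes "finite F" "F \<subseteq> E" "finite S"
  shows "(\<lambda>r. occ_prob F r S) \<in> borel_measurable borel"
proof -
  have "(\<lambda>r. - occ_prob F r S) \<in> borel_measurable borel"
    using occ_prob_mono[OF assms] by (intro borel_measurable_mono) (auto simp: mono_def)
  then show ?thesis by (subst (asm) borel_measurable_uminus_eq)
qed

lemma occ_prob_bounds: "0 \<le> occ_prob F s S" "occ_prob F s S \<le> 1"
  by (auto simp: occ_prob_def)

lemma pred_occ_all:
  assumes "finite F" "F \<subseteq> K" "F \<subseteq> E" "finite S"
  shows "Measurable.pred (borel \<Otimes>\<^sub>M PiM K edge_space)
    (\<lambda>p. \<forall>x\<in>S. occupied_before F (\<lambda>e. fst (snd p e)) (\<lambda>e. snd (snd p e)) (fst p) x)"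
  using assms finite_edge by (intro pred_intros_finite(3) pred_occ) auto

lemma pred_occ_all_const:
  assumes "finite F" "F \<subseteq> K" "F \<subseteq> E" "finite S"
  shows "Measurable.pred (PiM K edge_space)
    (\<lambda>z. \<forall>x\<in>S. occupied_before F (\<lambda>e. fst (z e)) (\<lambda>e. snd (z e)) s x)"
  using measurable_compose[OF _ pred_occ_all[OF assms], of "\<lambda>z. (s, z)" "PiM K edge_space"] by simp

lemma prob_edge_occ:
  assumes "e \<in> E" "c \<in> e" "F \<subseteq> E" "e \<notin> F" "finite F" "finite S" "0 \<le> t" "t \<le> 1"
  shows "prob {\<omega>\<in>space M. \<tau> e \<omega> < t \<and> \<kappa> e \<omega> = c \<and> (\<forall>x\<in>S. occ F (\<tau> e \<omega>) x \<omega>)} =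
    (LINT r:{0..t}|lborel. occ_prob F r S) / 2"
  using prob_edge_marks[OF assms(1-4,7,8) pred_occ_all[OF assms(5) order.refl assms(3,6)]]
  by (simp add: occ_prob_def occ_marks[OF order.refl, of F])

lemma prob_occ_indep:
  assumes "finite F" "finite G" "F \<subseteq> E" "G \<subseteq> E" "F \<inter> G = {}" "finite S" "finite T"
  shows "prob {\<omega>\<in>space M. (\<forall>x\<in>S. occ F s x \<omega>) \<and> (\<forall>x\<in>T. occ G s x \<omega>)} =
    occ_prob F s S * occ_prob G s T"
  using indep_marks[OF assms(3,4,5)
      pred_occ_all_const[OF assms(1) order.refl assms(3) assms(6)]
      pred_occ_all_const[OF assms(2) order.refl assms(4) assms(7)], of s s]
  by (simp add: occ_prob_def occ_marks[OF order.refl, of F] occ_marks[OF order.refl, of G])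

lemma prob_\<tau>_eq: 
  assumes "e \<in> E"
  shows "prob {\<omega>\<in>space M. \<tau> e \<omega> = r} = 0"
proof -
  have "e \<noteq> {}" "finite e" using card_edge[OF assms] finite_edge[OF assms] by auto
  then interpret C: prob_space "uniform_count_measure e"
    by (intro prob_space_uniform_count_measure)
  have "{\<omega>\<in>space M. \<tau> e \<omega> = r} = (\<lambda>\<omega>. (\<tau> e \<omega>, \<kappa> e \<omega>)) -` ({r} \<times> e) \<inter> space M"
    using \<kappa>_in[OF assms] by auto
  then have "emeasure M {\<omega>\<in>space M. \<tau> e \<omega> = r} =
      emeasure (distr M (edge_space e) (\<lambda>\<omega>. (\<tau> e \<omega>, \<kappa> e \<omega>))) ({r} \<times> e)"
    by (simp add: emeasure_distr edge_measurable[OF assms])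
  also have "\<dots> = emeasure (uniform_measure lborel {0<..<1}) {r} * emeasure (uniform_count_measure e) e"
    unfolding law_edge[OF assms] by (subst C.emeasure_pair_measure_Times) (auto simp: sets_uniform_count_measure)
  also have "emeasure (uniform_measure lborel {0<..<1}) {r} = 0"
    by (cases "r \<in> {0<..<1}") (auto simp: emeasure_uniform_measure Int_insert_right)
  finally show ?thesis by (simp add: measure_def)
qed

text \<open>The first edge of the chain is one of at most \<open>D\<close> edges, and its clock \<open>r\<close> is uniform and independent
  of the rest; so the bound for \<open>d + 1\<close> is \<open>D\<close> times the integral over \<open>r \<le> s\<close> of the bound for \<open>d\<close> at \<open>r\<close>.\<close>

lemma prob_dec_path:
  assumes deg: "\<And>v. finite {e\<in>E. v \<in> e}" "\<And>v. card {e\<in>E. v \<in> e} \<le> D"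
  shows "F \<subseteq> E \<Longrightarrow> 0 \<le> s \<Longrightarrow> s \<le> 1 \<Longrightarrow>
    {\<omega>\<in>space M. dec_path d F (\<lambda>e. \<tau> e \<omega>) s v} \<in> events \<and>
    prob {\<omega>\<in>space M. dec_path d F (\<lambda>e. \<tau> e \<omega>) s v} \<le> (real D * s) ^ d / fact d"
proof (induction d arbitrary: F s v)
  case (Suc d)
  have finF: "finite {e\<in>F. v \<in> e}" for v
    by (rule finite_subset[OF _ deg(1)[of v]]) (use Suc.prems(1) in auto)
  define Q where "Q e u r z \<longleftrightarrow> dec_path d (F - {e}) (\<lambda>f. fst (z f)) r u" 
    for e u r and z :: "'a set \<Rightarrow> real \<times> 'a"
  have Q: "Measurable.pred (borel \<Otimes>\<^sub>M PiM (F - {e}) edge_space) (\<lambda>p. Q e u (fst p) (snd p))" for e u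
    unfolding Q_def using Suc.prems(1) finite_edge finF
    by (intro pred_dec_path) (auto intro: rev_finite_subset)
  have marks: "Q e u r (marks (F - {e}) \<omega>) \<longleftrightarrow> dec_path d (F - {e}) (\<lambda>f. \<tau> f \<omega>) r u" for e u r \<omega>
    unfolding Q_def by (rule dec_path_cong) (auto simp: marks_def)
  define g where "g e u r = prob {\<omega>\<in>space M. dec_path d (F - {e}) (\<lambda>f. \<tau> f \<omega>) r u}" for e u r
  define A where "A e u c = {\<omega>\<in>space M. \<tau> e \<omega> < s \<and> \<kappa> e \<omega> = c \<and> dec_path d (F - {e}) (\<lambda>f. \<tau> f \<omega>) (\<tau> e \<omega>) u}"
    for e u c
  have F_marks: "marks (F - {e}) \<in> M \<rightarrow>\<^sub>M PiM (F - {e}) edge_space" for e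
    using Suc.prems(1) by (intro marks_measurable) auto
  have A_events: "A e u c \<in> events" if "e \<in> F" "c \<in> e" for e u c
  proof -
    have \<tau>m: "\<tau> e \<in> borel_measurable M" using \<tau>_measurable that Suc.prems by auto
    have "(\<lambda>\<omega>. (\<tau> e \<omega>, marks (F - {e}) \<omega>)) \<in> M \<rightarrow>\<^sub>M borel \<Otimes>\<^sub>M PiM (F - {e}) edge_space"
      using F_marks \<tau>m by measurable
    from measurable_compose[OF this Q[of e u]]
    have 1: "Measurable.pred M (\<lambda>\<omega>. dec_path d (F - {e}) (\<lambda>f. \<tau> f \<omega>) (\<tau> e \<omega>) u)"
      by (simp add: marks)
    have "\<kappa> e \<in> M \<rightarrow>\<^sub>M count_space e"
      using measurable_compose[OF edge_measurable measurable_snd, of e] that Suc.prems by auto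
    from measurable_compose[OF this, of "\<lambda>x. x = c" "count_space UNIV"]
    have 2: "Measurable.pred M (\<lambda>\<omega>. \<kappa> e \<omega> = c)" by simp
    have 3: "Measurable.pred M (\<lambda>\<omega>. \<tau> e \<omega> < s)" using \<tau>m by measurable
    show ?thesis unfolding A_def by (intro predE pred_intros_logic 1 2 3)
  qed
  have bound: "prob (A e u c) \<le> (LINT r:{0..s}|lborel. (real D * r) ^ d / fact d) / 2"
    if "e \<in> F" "c \<in> e" for e u c
  proof -
    have "prob (A e u c) = (LINT r:{0..s}|lborel. g e u r) / 2"
      using prob_edge_marks[OF _ that(2) _ _ Suc.prems(2,3) Q[of e u]] that Suc.prems(1)
      unfolding A_def g_def marks by auto
    also have "\<dots> \<le> (LINT r:{0..s}|lborel. (real D * r) ^ d / fact d) / 2"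
    proof (intro divide_right_mono set_integral_mono)
      have "mono (\<lambda>r. prob {\<omega>\<in>space M. dec_path d (F - {e}) (\<lambda>f. \<tau> f \<omega>) r u})"
      proof (intro monoI finite_measure_mono)
        fix r :: real
        have "(\<lambda>\<omega>. (r, marks (F - {e}) \<omega>)) \<in> M \<rightarrow>\<^sub>M borel \<Otimes>\<^sub>M PiM (F - {e}) edge_space"
          using F_marks by measurable
        from measurable_compose[OF this Q[of e u]]
        show "{\<omega>\<in>space M. dec_path d (F - {e}) (\<lambda>f. \<tau> f \<omega>) r u} \<in> events"
          by (simp add: marks pred_def)
      qed (auto intro: dec_path_mono)
      then show "set_integrable lborel {0..s} (g e u)"
        unfolding g_def by (intro set_integrable_unit borel_measurable_mono) auto
      show "set_integrable lborel {0..s} (\<lambda>r. (real D * r) ^ d / fact d)"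
        using Suc.prems by (intro LINT_power_over_fact)
      show "g e u r \<le> (real D * r) ^ d / fact d" if "r \<in> {0..s}" for r
        using Suc.IH[of "F - {e}" r u] Suc.prems that by (auto simp: g_def)
    qed auto
    finally show ?thesis .
  qed
  let ?I = "LINT r:{0..s}|lborel. (real D * r) ^ d / fact d"
  have I0: "0 \<le> ?I"
    unfolding set_lebesgue_integral_def using Suc.prems
    by (intro integral_nonneg_AE) (auto simp: indicator_def)
  have union: "{\<omega>\<in>space M. dec_path (Suc d) F (\<lambda>e. \<tau> e \<omega>) s v} =
      (\<Union>e\<in>{e\<in>F. v \<in> e}. \<Union>u\<in>e - {v}. \<Union>c\<in>e. A e u c)"
    (is "?L = ?R")
  proof (intro set_eqI iffI)
    fix \<omega> assume "\<omega> \<in> ?L"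
    then obtain e u where "\<omega> \<in> space M" "e \<in> F" "v \<in> e" "\<tau> e \<omega> < s" "u \<in> e - {v}"
        "dec_path d (F - {e}) (\<lambda>f. \<tau> f \<omega>) (\<tau> e \<omega>) u" by auto
    moreover from this have "\<omega> \<in> A e u (\<kappa> e \<omega>)" "\<kappa> e \<omega> \<in> e"
      using \<kappa>_in[of e \<omega>] Suc.prems by (auto simp: A_def)
    ultimately show "\<omega> \<in> ?R" by blast
  next
    fix \<omega> assume "\<omega> \<in> ?R"
    then obtain e u c where "e \<in> F" "v \<in> e" "u \<in> e - {v}" "\<omega> \<in> A e u c" by blast
    then show "\<omega> \<in> ?L" by (auto simp: A_def)
  qed
  have fe: "finite e" if "e \<in> F" for e using that Suc.prems finite_edge by auto
  have ev: "(\<Union>c\<in>e. A e u c) \<in> events" if "e \<in> F" for e u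
    using that fe A_events by (intro sets.finite_UN) auto
  have ev2: "(\<Union>u\<in>e - {v}. \<Union>c\<in>e. A e u c) \<in> events" if "e \<in> F" for e
    using that fe by (rule_tac sets.finite_UN) (auto intro!: ev[OF that])
  have "prob (\<Union>e\<in>{e\<in>F. v \<in> e}. \<Union>u\<in>e - {v}. \<Union>c\<in>e. A e u c)
      \<le> (\<Sum>e\<in>{e\<in>F. v \<in> e}. prob (\<Union>u\<in>e - {v}. \<Union>c\<in>e. A e u c))"
    using finF by (intro finite_measure_subadditive_finite) (auto intro!: ev2)
  also have "\<dots> \<le> (\<Sum>e\<in>{e\<in>F. v \<in> e}. \<Sum>u\<in>e - {v}. prob (\<Union>c\<in>e. A e u c))"
    using fe by (intro sum_mono finite_measure_subadditive_finite) (auto intro!: ev)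
  also have "\<dots> \<le> (\<Sum>e\<in>{e\<in>F. v \<in> e}. \<Sum>u\<in>e - {v}. \<Sum>c\<in>e. prob (A e u c))"
    using fe by (intro sum_mono finite_measure_subadditive_finite) (auto intro!: A_events)
  also have "\<dots> \<le> (\<Sum>e\<in>{e\<in>F. v \<in> e}. \<Sum>u\<in>e - {v}. \<Sum>c\<in>e. ?I / 2)"
    using bound by (intro sum_mono) auto
  also have "\<dots> = (\<Sum>e\<in>{e\<in>F. v \<in> e}. ?I)"
  proof (rule sum.cong[OF refl])
    fix e assume "e \<in> {e\<in>F. v \<in> e}"
    then have "card e = 2" "card (e - {v}) = 1" using card_edge Suc.prems by auto
    then show "(\<Sum>u\<in>e - {v}. \<Sum>c\<in>e. ?I / 2) = ?I" by simp
  qed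
  also have "\<dots> = card {e\<in>F. v \<in> e} * ?I" by simp
  also have "\<dots> \<le> D * ?I"
  proof (intro mult_right_mono I0)
    have "card {e\<in>F. v \<in> e} \<le> card {e\<in>E. v \<in> e}"
      using Suc.prems(1) deg(1) by (intro card_mono) auto
    with deg(2)[of v] show "real (card {e\<in>F. v \<in> e}) \<le> D" by linarith
  qed
  also have "\<dots> = (real D * s) ^ Suc d / fact (Suc d)"
    using Suc.prems by (intro LINT_power_over_fact)
  finally have "prob (\<Union>e\<in>{e\<in>F. v \<in> e}. \<Union>u\<in>e - {v}. \<Union>c\<in>e. A e u c)
      \<le> (real D * s) ^ Suc d / fact (Suc d)" .
  moreover have "(\<Union>e\<in>{e\<in>F. v \<in> e}. \<Union>u\<in>e - {v}. \<Union>c\<in>e. A e u c) \<in> events"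
    using finF by (rule_tac sets.finite_UN) (auto intro!: ev2)
  ultimately show ?case unfolding union by blast
qed simp

end

section \<open>Leaf and gluing identities and their limits\<close>

text \<open>Where \<open>P n \<omega>\<close> is not eventually constant, \<open>lim\<close> is an arbitrary but fixed real, so the integrand on the right is
  measurable everywhere and correct almost everywhere.\<close>

lemma (in prob_space) prob_tendsto_lim:
  assumes pred: "\<And>n. Measurable.pred M (P n)"
    and const: "AE \<omega> in M. \<exists>b. eventually (\<lambda>n. P n \<omega> = b) sequentially"
  shows "(\<lambda>n. prob {\<omega>\<in>space M. P n \<omega>}) \<longlonglongrightarrow> (\<integral>\<omega>. lim (\<lambda>n. of_bool (P n \<omega>)) \<partial>M)"
proof -
  have meas: "(\<lambda>\<omega>. of_bool (P n \<omega>) :: real) \<in> borel_measurable M" for n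
    using measurable_compose[OF pred[of n], of of_bool borel] by simp
  have "(\<lambda>n. \<integral>\<omega>. (of_bool (P n \<omega>) :: real) \<partial>M) \<longlonglongrightarrow> (\<integral>\<omega>. lim (\<lambda>n. of_bool (P n \<omega>)) \<partial>M)"
  proof (rule integral_dominated_convergence[where w="\<lambda>_. 1::real"])
    show "AE \<omega> in M. (\<lambda>n. of_bool (P n \<omega>) :: real) \<longlonglongrightarrow> lim (\<lambda>n. of_bool (P n \<omega>))"
      using const
    proof eventually_elim
      case (elim \<omega>)
      then obtain b where "eventually (\<lambda>n. P n \<omega> = b) sequentially" by blast
      then have "eventually (\<lambda>n. (of_bool (P n \<omega>) :: real) = of_bool b) sequentially"
        by eventually_elim simp
      then have "(\<lambda>n. of_bool (P n \<omega>) :: real) \<longlonglongrightarrow> of_bool b"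
        by (rule tendsto_eventually)
      then show ?case by (simp add: limI)
    qed
  qed (use meas in \<open>auto intro: borel_measurable_lim_metric\<close>)
  moreover have "(\<integral>\<omega>. (of_bool (P n \<omega>) :: real) \<partial>M) = prob {\<omega>\<in>space M. P n \<omega>}" for n
  proof -
    have "(\<integral>\<omega>. (of_bool (P n \<omega>) :: real) \<partial>M) = (\<integral>\<omega>. indicator {\<omega>\<in>space M. P n \<omega>} \<omega> \<partial>M :: real)"
      by (intro Bochner_Integration.integral_cong) (auto simp: indicator_def)
    then show ?thesis using pred[of n] by (simp add: pred_def)
  qed
  ultimately show ?thesis by simp
qed

context pair_annihilation
begin

lemma card2_other: "{v, x} \<in> E \<Longrightarrow> v \<noteq> x"
  using card_edge[of "{v, x}"] by auto

lemma occ_leaf: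
  assumes "finite F" "{v, x} \<in> F" "F \<subseteq> E" "v \<notin> \<Union>(F - {{v, x}})"
  shows "occ F t v \<omega> \<longleftrightarrow> \<not> (\<tau> {v, x} \<omega> < t \<and> \<kappa> {v, x} \<omega> = v \<and> occ (F - {{v, x}}) (\<tau> {v, x} \<omega>) x \<omega>)"
proof -
  have "v \<in> e \<longleftrightarrow> e = {v, x}" if "e \<in> F" for e using that assms by auto
  moreover have "{v, x} - {v} = {x}" using assms card2_other[of v x] by auto
  ultimately show ?thesis
    using assms(2) unfolding occ_def occ_rec[OF assms(1)] by auto
qed

lemma pred_occ_\<tau>:
  assumes "finite F" "F \<subseteq> E" "e \<in> E"
  shows "Measurable.pred M (\<lambda>\<omega>. occ F (\<tau> e \<omega>) v \<omega>)"
  using assms by (intro pred_occ_marks \<tau>_measurable)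

lemma kill_event:
  assumes "finite F" "F \<subseteq> E" "e \<in> E" "finite S"
  shows "{\<omega>\<in>space M. \<tau> e \<omega> < t \<and> \<kappa> e \<omega> = c \<and> (\<forall>x\<in>S. occ F (\<tau> e \<omega>) x \<omega>)} \<in> events"
proof -
  have "\<kappa> e \<in> M \<rightarrow>\<^sub>M count_space e"
    using measurable_compose[OF edge_measurable measurable_snd, of e] assms by auto
  from measurable_compose[OF this, of "\<lambda>x. x = c" "count_space UNIV"]
  have 2: "Measurable.pred M (\<lambda>\<omega>. \<kappa> e \<omega> = c)" by simp
  have 3: "Measurable.pred M (\<lambda>\<omega>. \<tau> e \<omega> < t)" using \<tau>_measurable[OF assms(3)] by measurable
  show ?thesis
    using assms by (intro predE pred_intros_logic 2 3 pred_intros_finite(3) pred_occ_\<tau>) auto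
qed

lemma occ_prob_leaf:
  assumes "finite F" "{v, x} \<in> F" "F \<subseteq> E" "v \<notin> \<Union>(F - {{v, x}})" "0 \<le> t" "t \<le> 1"
  shows "occ_prob F t {v} = 1 - (LINT r:{0..t}|lborel. occ_prob (F - {{v, x}}) r {x}) / 2"
proof -
  let ?e = "{v, x}"
  let ?A = "{\<omega>\<in>space M. \<tau> ?e \<omega> < t \<and> \<kappa> ?e \<omega> = v \<and> (\<forall>y\<in>{x}. occ (F - {?e}) (\<tau> ?e \<omega>) y \<omega>)}"
  have "{\<omega>\<in>space M. \<forall>y\<in>{v}. occ F t y \<omega>} = space M - ?A"
    using occ_leaf[OF assms(1-4), of t] by auto
  then have "occ_prob F t {v} = prob (space M - ?A)"
    unfolding occ_prob_def by (rule arg_cong)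
  also have "\<dots> = 1 - prob ?A"
    using assms by (intro prob_compl kill_event) auto
  also have "prob ?A = (LINT r:{0..t}|lborel. occ_prob (F - {?e}) r {x}) / 2"
    using assms by (intro prob_edge_occ) auto
  finally show ?thesis .
qed

lemma prob_tie:
  assumes "e \<in> E" "f \<in> E" "e \<noteq> f" "0 \<le> t" "t \<le> 1" "c \<in> e"
  shows "prob {\<omega>\<in>space M. \<tau> e \<omega> < t \<and> \<kappa> e \<omega> = c \<and> \<tau> f \<omega> = \<tau> e \<omega>} = 0"
proof -
  have comp: "(\<lambda>p. snd p f) \<in> borel \<Otimes>\<^sub>M PiM {f} edge_space \<rightarrow>\<^sub>M edge_space f"
    by measurable
  have "Measurable.pred (borel \<Otimes>\<^sub>M PiM {f} edge_space) (\<lambda>p. fst (snd p f) = fst p)"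
    using measurable_compose[OF comp measurable_fst] by measurable
  then have "prob {\<omega>\<in>space M. \<tau> e \<omega> < t \<and> \<kappa> e \<omega> = c \<and> \<tau> f \<omega> = \<tau> e \<omega>} =
      (LINT r:{0..t}|lborel. prob {\<omega>\<in>space M. \<tau> f \<omega> = r}) / 2"
    using prob_edge_marks[of e c "{f}" t "\<lambda>r z. fst (z f) = r"] assms by (simp add: marks_def)
  then show ?thesis using prob_\<tau>_eq[OF assms(2)] by simp
qed

text \<open>Here \<open>a\<close> and \<open>b\<close> are the clocks of the edges at two leaves, \<open>p\<close> and \<open>q\<close> say that these edges kill
  their leaves, and \<open>v\<close>, \<open>w\<close> say that the one leaf is occupied just before the edge of the other acts. If some leaf
  is killed, then the first one to be killed goes while the other is still occupied.\<close>

lemma earlier_kill: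
  fixes a b t :: real
  assumes "w \<longleftrightarrow> \<not> (b < a \<and> q)" "v \<longleftrightarrow> \<not> (a < b \<and> p)"
  shows "\<not> (a < t \<and> p \<and> w) \<Longrightarrow> \<not> (b < t \<and> q \<and> v) \<Longrightarrow> \<not> (a < t \<and> p) \<and> \<not> (b < t \<and> q)"
    and "p \<Longrightarrow> q \<Longrightarrow> v \<Longrightarrow> w \<Longrightarrow> b = a"
  using assms by (cases rule: linorder_cases[of a b]; force)+

text \<open>The event that not both leaves are occupied is split according to which leaf is killed first. The
  two cases overlap only if the two clocks agree, which has probability \<open>0\<close>. The two edges may coincide,
  as happens when \<open>v\<close> and \<open>w\<close> are neighbours.\<close>

lemma occ_prob_leaf_pair:
  assumes F: "finite F" "F \<subseteq> E" and "v \<noteq> w" and t: "0 \<le> t" "t \<le> 1"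
    and v: "{v, x} \<in> F" "v \<notin> \<Union>(F - {{v, x}})"
    and w: "{w, z} \<in> F" "w \<notin> \<Union>(F - {{w, z}})"
  shows "occ_prob F t {v, w} = 1
    - (LINT r:{0..t}|lborel. occ_prob (F - {{v, x}}) r {x, w}) / 2
    - (LINT r:{0..t}|lborel. occ_prob (F - {{w, z}}) r {z, v}) / 2"
proof -
  let ?e = "{v, x}" and ?f = "{w, z}"
  define A where "A = {\<omega>\<in>space M. \<tau> ?e \<omega> < t \<and> \<kappa> ?e \<omega> = v \<and> (\<forall>y\<in>{x, w}. occ (F - {?e}) (\<tau> ?e \<omega>) y \<omega>)}"
  define B where "B = {\<omega>\<in>space M. \<tau> ?f \<omega> < t \<and> \<kappa> ?f \<omega> = w \<and> (\<forall>y\<in>{z, v}. occ (F - {?f}) (\<tau> ?f \<omega>) y \<omega>)}"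
  have AB: "A \<in> events" "B \<in> events"
  proof -
    show "A \<in> events" unfolding A_def by (rule kill_event) (use F v(1) in auto)
    show "B \<in> events" unfolding B_def by (rule kill_event) (use F w(1) in auto)
  qed
  have de: "occ (F - {?e}) (\<tau> ?e \<omega>) y \<omega> \<longleftrightarrow> occ F (\<tau> ?e \<omega>) y \<omega>" for y \<omega>
    unfolding occ_def by (rule occ_delete[symmetric]) (use F in auto)
  have df: "occ (F - {?f}) (\<tau> ?f \<omega>) y \<omega> \<longleftrightarrow> occ F (\<tau> ?f \<omega>) y \<omega>" for y \<omega>
    unfolding occ_def by (rule occ_delete[symmetric]) (use F in auto)
  define P where "P \<omega> \<longleftrightarrow> \<kappa> ?e \<omega> = v \<and> occ F (\<tau> ?e \<omega>) x \<omega>" for \<omega>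
  define Q where "Q \<omega> \<longleftrightarrow> \<kappa> ?f \<omega> = w \<and> occ F (\<tau> ?f \<omega>) z \<omega>" for \<omega>
  have ov: "occ F s v \<omega> \<longleftrightarrow> \<not> (\<tau> ?e \<omega> < s \<and> P \<omega>)" for s \<omega>
    unfolding P_def de[symmetric] by (rule occ_leaf) (use F v in auto)
  have ow: "occ F s w \<omega> \<longleftrightarrow> \<not> (\<tau> ?f \<omega> < s \<and> Q \<omega>)" for s \<omega>
    unfolding Q_def df[symmetric] by (rule occ_leaf) (use F w in auto)
  have A_iff: "\<omega> \<in> A \<longleftrightarrow> \<omega> \<in> space M \<and> \<tau> ?e \<omega> < t \<and> P \<omega> \<and> occ F (\<tau> ?e \<omega>) w \<omega>" for \<omega>
    unfolding A_def P_def de by blast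
  have B_iff: "\<omega> \<in> B \<longleftrightarrow> \<omega> \<in> space M \<and> \<tau> ?f \<omega> < t \<and> Q \<omega> \<and> occ F (\<tau> ?f \<omega>) v \<omega>" for \<omega>
    unfolding B_def Q_def df by blast
  have union: "{\<omega>\<in>space M. \<forall>y\<in>{v, w}. occ F t y \<omega>} = space M - (A \<union> B)"
  proof -
    have "occ F t v \<omega> \<and> occ F t w \<omega> \<longleftrightarrow> \<omega> \<notin> A \<and> \<omega> \<notin> B" if "\<omega> \<in> space M" for \<omega>
      unfolding A_iff B_iff ov[of t] ow[of t]
      using earlier_kill(1)[OF ow[of "\<tau> ?e \<omega>" \<omega>] ov[of "\<tau> ?f \<omega>" \<omega>], of t] that by argo
    then show ?thesis by auto
  qed
  have null: "prob (A \<inter> B) = 0"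
  proof (cases "?e = ?f")
    case True
    then have "\<kappa> ?e \<omega> = v \<Longrightarrow> \<kappa> ?f \<omega> \<noteq> w" for \<omega>
      using \<open>v \<noteq> w\<close> by metis
    then have "A \<inter> B = {}" unfolding A_def B_def by blast
    then show ?thesis by simp
  next
    case False
    have "A \<inter> B \<subseteq> {\<omega>\<in>space M. \<tau> ?e \<omega> < t \<and> \<kappa> ?e \<omega> = v \<and> \<tau> ?f \<omega> = \<tau> ?e \<omega>}"
    proof
      fix \<omega> assume "\<omega> \<in> A \<inter> B"
      then have 1: "\<omega> \<in> space M" "\<tau> ?e \<omega> < t" "P \<omega>" "Q \<omega>" "occ F (\<tau> ?e \<omega>) w \<omega>" "occ F (\<tau> ?f \<omega>) v \<omega>"
        by (simp_all only: Int_iff A_iff B_iff)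
      then have "\<tau> ?f \<omega> = \<tau> ?e \<omega>" by (intro earlier_kill(2)[OF ow[of "\<tau> ?e \<omega>" \<omega>] ov[of "\<tau> ?f \<omega>" \<omega>]])
      with 1 show "\<omega> \<in> {\<omega>\<in>space M. \<tau> ?e \<omega> < t \<and> \<kappa> ?e \<omega> = v \<and> \<tau> ?f \<omega> = \<tau> ?e \<omega>}"
        by (simp add: P_def)
    qed
    moreover have "{\<omega>\<in>space M. \<tau> ?e \<omega> < t \<and> \<kappa> ?e \<omega> = v \<and> \<tau> ?f \<omega> = \<tau> ?e \<omega>} \<in> events"
    proof -
      have e: "?e \<in> E" "?f \<in> E" using F v w by auto
      have "{\<omega>\<in>space M. \<tau> ?f \<omega> = \<tau> ?e \<omega>} \<in> events"
        using \<tau>_measurable[OF e(1)] \<tau>_measurable[OF e(2)] by measurable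
      moreover have "{\<omega>\<in>space M. \<tau> ?e \<omega> < t \<and> \<kappa> ?e \<omega> = v \<and> (\<forall>y\<in>{}. occ {} (\<tau> ?e \<omega>) y \<omega>)} \<in> events"
        using e by (intro kill_event) auto
      ultimately have "{\<omega>\<in>space M. \<tau> ?e \<omega> < t \<and> \<kappa> ?e \<omega> = v \<and> (\<forall>y\<in>{}. occ {} (\<tau> ?e \<omega>) y \<omega>)} \<inter>
          {\<omega>\<in>space M. \<tau> ?f \<omega> = \<tau> ?e \<omega>} \<in> events"
        by (rule sets.Int[rotated])
      also have "{\<omega>\<in>space M. \<tau> ?e \<omega> < t \<and> \<kappa> ?e \<omega> = v \<and> (\<forall>y\<in>{}. occ {} (\<tau> ?e \<omega>) y \<omega>)} \<inter>
          {\<omega>\<in>space M. \<tau> ?f \<omega> = \<tau> ?e \<omega>} =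
          {\<omega>\<in>space M. \<tau> ?e \<omega> < t \<and> \<kappa> ?e \<omega> = v \<and> \<tau> ?f \<omega> = \<tau> ?e \<omega>}"
        by blast
      finally show ?thesis .
    qed
    ultimately have "prob (A \<inter> B) \<le> prob {\<omega>\<in>space M. \<tau> ?e \<omega> < t \<and> \<kappa> ?e \<omega> = v \<and> \<tau> ?f \<omega> = \<tau> ?e \<omega>}"
      by (rule finite_measure_mono)
    also have "\<dots> = 0"
      using F v w t False by (intro prob_tie) auto
    finally show ?thesis by (simp add: measure_le_0_iff)
  qed
  have "occ_prob F t {v, w} = prob (space M - (A \<union> B))"
    unfolding occ_prob_def union ..
  also have "\<dots> = 1 - prob (A \<union> B)"
    using AB by (intro prob_compl) auto
  also have "prob (A \<union> B) = prob A + prob B - prob (A \<inter> B)"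
    using AB by (intro measure_Un3) (auto simp: fmeasurable_eq_sets)
  also have "prob A = (LINT r:{0..t}|lborel. occ_prob (F - {?e}) r {x, w}) / 2"
    unfolding A_def using F v t by (intro prob_edge_occ) auto
  also have "prob B = (LINT r:{0..t}|lborel. occ_prob (F - {?f}) r {z, v}) / 2"
    unfolding B_def using F w t by (intro prob_edge_occ) auto
  finally show ?thesis using null by simp
qed

lemma occ_prob_glue:
  assumes "finite F1" "finite F2" "F1 \<subseteq> E" "F2 \<subseteq> E" "F1 \<inter> F2 = {}"
    and meet: "\<Union>F1 \<inter> \<Union>F2 \<subseteq> {v}" and S: "finite S" "S \<inter> \<Union>F1 \<subseteq> {v}"
  shows "occ_prob (F1 \<union> F2) s (insert v S) = occ_prob F1 s {v} * occ_prob F2 s (insert v S)"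
proof -
  have "(\<forall>y\<in>insert v S. occ (F1 \<union> F2) s y \<omega>) \<longleftrightarrow>
      (\<forall>y\<in>{v}. occ F1 s y \<omega>) \<and> (\<forall>y\<in>insert v S. occ F2 s y \<omega>)" for \<omega>
  proof (cases "occ (F1 \<union> F2) s v \<omega>")
    case True
    have "occ (F1 \<union> F2) s y \<omega> \<longleftrightarrow> occ F2 s y \<omega>" if "y \<in> S" for y
    proof -
      have "\<Union>F2 \<inter> \<Union>F1 \<subseteq> {v}" "y = v \<or> y \<notin> \<Union>F1" using meet S that by auto
      moreover have "occupied_before (F2 \<union> F1) (\<lambda>e. \<tau> e \<omega>) (\<lambda>e. \<kappa> e \<omega>) s v"
        using True by (simp add: occ_def Un_commute)
      ultimately show ?thesis
        using occ_glue_side[OF assms(2,1) _ _ order.refl] unfolding occ_def by (simp add: Un_commute)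
    qed
    with True show ?thesis
      using occ_glue[OF assms(1,2) meet] unfolding occ_def by auto
  next
    case False
    then show ?thesis
      using occ_glue[OF assms(1,2) meet] unfolding occ_def by auto
  qed
  then show ?thesis
    using prob_occ_indep[OF assms(1-5), of "{v}" "insert v S" s] S
    unfolding occ_prob_def by simp
qed

lemma occ_isolated: 
  assumes "finite F" "v \<notin> \<Union>F"
  shows "occ F s v \<omega>"
  unfolding occ_def occ_rec[OF assms(1)] using assms(2) by auto

lemma occ_prob_isolated: 
  assumes "finite F" "v \<notin> \<Union>F"
  shows "occ_prob F s (insert v S) = occ_prob F s S"
  using occ_isolated[OF assms] by (simp add: occ_prob_def)

lemma occ_prob_empty: "occ_prob F s {} = 1"
  by (simp add: occ_prob_def prob_space)

end

text \<open>\<open>G n\<close> are the edge sets of the finite subgraphs along which the infinite process is defined. In the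
  limit quantities below, \<open>F\<close> ranges over infinite edge sets, approximated by \<open>F \<inter> G n\<close>.\<close>

locale annihilation_limit = pair_annihilation M E \<tau> \<kappa>
  for M :: "'\<omega> measure" and E :: "'a set set" and \<tau> \<kappa> +
  fixes D :: nat and G :: "nat \<Rightarrow> 'a set set"
  assumes finite_G: "finite (G n)" and G_subset: "G n \<subseteq> E"
    and eventually_G: "e \<in> E \<Longrightarrow> eventually (\<lambda>n. e \<in> G n) sequentially"
    and finite_incident: "finite {e\<in>E. v \<in> e}" and card_incident: "card {e\<in>E. v \<in> e} \<le> D"
begin

text \<open>By the bound on decreasing chains, almost surely there is a length that no chain from \<open>v\<close> attains.\<close>

lemma occ_eventually_const:
  assumes "F \<subseteq> E" "0 \<le> s" "s \<le> 1"
  shows "AE \<omega> in M. \<exists>b. eventually (\<lambda>n. occ (F \<inter> G n) s v \<omega> = b) sequentially"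
proof -
  define A where "A d = {\<omega>\<in>space M. dec_path d F (\<lambda>e. \<tau> e \<omega>) s v}" for d
  note bound = prob_dec_path[OF finite_incident card_incident assms, of _ v, folded A_def]
  have events: "(\<Inter>d. A d) \<in> events" using bound by blast
  have "(\<lambda>d. inverse (fact d) *\<^sub>R (real D * s) ^ d) \<longlonglongrightarrow> 0"
    by (intro summable_LIMSEQ_zero summable_exp_generic)
  then have "prob (\<Inter>d. A d) \<le> 0"
  proof (rule LIMSEQ_le_const, intro exI allI impI)
    fix d
    have "prob (\<Inter>d. A d) \<le> prob (A d)" using bound by (intro finite_measure_mono) auto
    also have "\<dots> \<le> inverse (fact d) *\<^sub>R (real D * s) ^ d" 
      using bound by (simp add: field_simps)
    finally show "prob (\<Inter>d. A d) \<le> inverse (fact d) *\<^sub>R (real D * s) ^ d" .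
  qed
  then have "prob (\<Inter>d. A d) = 0" by (simp add: measure_le_0_iff)
  then have "(\<Inter>d. A d) \<in> null_sets M" using events by (simp add: null_setsI emeasure_eq_measure)
  then have "AE \<omega> in M. \<omega> \<notin> (\<Inter>d. A d)" by (rule AE_not_in)
  then show ?thesis
  proof (rule AE_mp, intro AE_I2 impI)
    fix \<omega> assume "\<omega> \<in> space M" "\<omega> \<notin> (\<Inter>d. A d)"
    then obtain d where "\<not> dec_path d F (\<lambda>e. \<tau> e \<omega>) s v" by (auto simp: A_def)
    with occ_eventually_constant[of G E F d] finite_G eventually_G finite_incident finite_edge assms(1)
    show "\<exists>b. eventually (\<lambda>n. occ (F \<inter> G n) s v \<omega> = b) sequentially"
      unfolding occ_def by blast
  qed
qed

definition lim_prob :: "'a set set \<Rightarrow> real \<Rightarrow> 'a set \<Rightarrow> real" where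
  "lim_prob F s S = lim (\<lambda>n. occ_prob (F \<inter> G n) s S)"

lemma finite_part: "finite (F \<inter> G n)" "F \<inter> G n \<subseteq> E"
  using finite_G G_subset by auto

lemma all_occ_eventually_const:
  assumes "F \<subseteq> E" "0 \<le> s" "s \<le> 1" "finite S"
  shows "AE \<omega> in M. \<exists>b. eventually (\<lambda>n. (\<forall>v\<in>S. occ (F \<inter> G n) s v \<omega>) = b) sequentially"
proof -
  have "AE \<omega> in M. \<forall>v\<in>S. \<exists>b. eventually (\<lambda>n. occ (F \<inter> G n) s v \<omega> = b) sequentially"
    using occ_eventually_const[OF assms(1-3)] assms(4) by (intro AE_finite_allI) auto
  then show ?thesis
  proof eventually_elim
    case (elim \<omega>)
    then obtain b where "\<And>v. v \<in> S \<Longrightarrow> eventually (\<lambda>n. occ (F \<inter> G n) s v \<omega> = b v) sequentially"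
      by metis
    then have "eventually (\<lambda>n. \<forall>v\<in>S. occ (F \<inter> G n) s v \<omega> = b v) sequentially"
      using assms(4) by (simp add: eventually_ball_finite)
    then have "eventually (\<lambda>n. (\<forall>v\<in>S. occ (F \<inter> G n) s v \<omega>) = (\<forall>v\<in>S. b v)) sequentially"
      by eventually_elim auto
    then show ?case by blast
  qed
qed

lemma occ_prob_tendsto_integral:
  assumes "F \<subseteq> E" "0 \<le> s" "s \<le> 1" "finite S"
  shows "(\<lambda>n. occ_prob (F \<inter> G n) s S) \<longlonglongrightarrow>
    (\<integral>\<omega>. lim (\<lambda>n. of_bool (\<forall>v\<in>S. occ (F \<inter> G n) s v \<omega>)) \<partial>M)"
  unfolding occ_prob_def
  using assms finite_part all_occ_eventually_const[OF assms]
  by (intro prob_tendsto_lim pred_intros_finite(3) pred_occ_const) auto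

lemma occ_prob_tendsto:
  assumes "F \<subseteq> E" "0 \<le> s" "s \<le> 1" "finite S"
  shows "(\<lambda>n. occ_prob (F \<inter> G n) s S) \<longlonglongrightarrow> lim_prob F s S"
  using occ_prob_tendsto_integral[OF assms] unfolding lim_prob_def by (simp add: limI)

lemma lim_prob_bounds:
  assumes "F \<subseteq> E" "0 \<le> s" "s \<le> 1" "finite S"
  shows "0 \<le> lim_prob F s S" "lim_prob F s S \<le> 1"
  using LIMSEQ_le_const[OF occ_prob_tendsto[OF assms]] LIMSEQ_le_const2[OF occ_prob_tendsto[OF assms]]
    occ_prob_bounds by blast+

lemma set_integral_tendsto:
  assumes "F \<subseteq> E" "0 \<le> t" "t \<le> 1" "finite S"
  shows "(\<lambda>n. LINT r:{0..t}|lborel. occ_prob (F \<inter> G n) r S) \<longlonglongrightarrow> (LINT r:{0..t}|lborel. lim_prob F r S)"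
    and "set_integrable lborel {0..t} (\<lambda>r. lim_prob F r S)"
proof -
  have meas: "(\<lambda>r. indicator {0..t} r *\<^sub>R occ_prob (F \<inter> G n) r S) \<in> borel_measurable lborel" for n
    using occ_prob_measurable[OF finite_part assms(4)] by measurable
  have conv: "(\<lambda>n. indicator {0..t} r *\<^sub>R occ_prob (F \<inter> G n) r S) \<longlonglongrightarrow> indicator {0..t} r *\<^sub>R lim_prob F r S" for r
    using occ_prob_tendsto[OF assms(1) _ _ assms(4)] assms(3) by (auto simp: indicator_def)
  have meas': "(\<lambda>r. indicator {0..t} r *\<^sub>R lim_prob F r S) \<in> borel_measurable lborel"
    by (rule borel_measurable_LIMSEQ_metric[OF meas conv])
  have int: "integrable lborel (\<lambda>r. indicator {0..t} r :: real)"
    using assms(2) by (intro integrable_real_indicator) auto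
  have bound: "norm (indicator {0..t} r *\<^sub>R occ_prob (F \<inter> G n) r S) \<le> indicator {0..t} r" for n r
    using occ_prob_bounds by (auto simp: indicator_def)
  show "(\<lambda>n. LINT r:{0..t}|lborel. occ_prob (F \<inter> G n) r S) \<longlonglongrightarrow> (LINT r:{0..t}|lborel. lim_prob F r S)"
    unfolding set_lebesgue_integral_def
    by (rule integral_dominated_convergence[where s="\<lambda>n r. indicator {0..t} r *\<^sub>R occ_prob (F \<inter> G n) r S", OF meas' meas int]) (use conv bound in auto)
  show "set_integrable lborel {0..t} (\<lambda>r. lim_prob F r S)"
    unfolding set_integrable_def
    by (rule integrable_dominated_convergence[where s="\<lambda>n r. indicator {0..t} r *\<^sub>R occ_prob (F \<inter> G n) r S", OF meas' meas int]) (use conv bound in auto)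
qed

lemma lim_prob_leaf:
  assumes "F \<subseteq> E" "{v, x} \<in> F" "v \<notin> \<Union>(F - {{v, x}})" "0 \<le> t" "t \<le> 1"
  shows "lim_prob F t {v} = 1 - (LINT r:{0..t}|lborel. lim_prob (F - {{v, x}}) r {x}) / 2"
proof -
  have ev: "eventually (\<lambda>n. {v, x} \<in> G n) sequentially" using assms eventually_G by auto
  have "eventually (\<lambda>n. occ_prob (F \<inter> G n) t {v} =
      1 - (LINT r:{0..t}|lborel. occ_prob ((F - {{v, x}}) \<inter> G n) r {x}) / 2) sequentially"
    using ev
  proof eventually_elim
    case (elim n)
    have "F \<inter> G n - {{v, x}} = (F - {{v, x}}) \<inter> G n" by auto
    then show ?case
      using occ_prob_leaf[OF finite_part(1) _ finite_part(2), of v x F n t] assms elim by auto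
  qed
  then have "(\<lambda>n. 1 - (LINT r:{0..t}|lborel. occ_prob ((F - {{v, x}}) \<inter> G n) r {x}) / 2) \<longlonglongrightarrow> lim_prob F t {v}"
    using occ_prob_tendsto[OF assms(1,4,5), of "{v}"] by (simp add: filterlim_cong[OF refl refl])
  moreover have "(\<lambda>n. 1 - (LINT r:{0..t}|lborel. occ_prob ((F - {{v, x}}) \<inter> G n) r {x}) / 2) \<longlonglongrightarrow>
      1 - (LINT r:{0..t}|lborel. lim_prob (F - {{v, x}}) r {x}) / 2"
    using assms by (intro tendsto_intros set_integral_tendsto) auto
  ultimately show ?thesis by (rule LIMSEQ_unique)
qed

lemma lim_prob_leaf_pair:
  assumes F: "F \<subseteq> E" and "v \<noteq> w" and t: "0 \<le> t" "t \<le> 1"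
    and v: "{v, x} \<in> F" "v \<notin> \<Union>(F - {{v, x}})"
    and w: "{w, z} \<in> F" "w \<notin> \<Union>(F - {{w, z}})"
  shows "lim_prob F t {v, w} = 1
    - (LINT r:{0..t}|lborel. lim_prob (F - {{v, x}}) r {x, w}) / 2
    - (LINT r:{0..t}|lborel. lim_prob (F - {{w, z}}) r {z, v}) / 2"
proof -
  have ev: "eventually (\<lambda>n. {v, x} \<in> G n) sequentially" "eventually (\<lambda>n. {w, z} \<in> G n) sequentially"
    using assms eventually_G by auto
  let ?R = "\<lambda>n. 1 - (LINT r:{0..t}|lborel. occ_prob ((F - {{v, x}}) \<inter> G n) r {x, w}) / 2
    - (LINT r:{0..t}|lborel. occ_prob ((F - {{w, z}}) \<inter> G n) r {z, v}) / 2"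
  have "eventually (\<lambda>n. occ_prob (F \<inter> G n) t {v, w} = ?R n) sequentially"
    using ev
  proof eventually_elim
    case (elim n)
    have "F \<inter> G n - {e} = (F - {e}) \<inter> G n" for e by auto
    then show ?case
      using occ_prob_leaf_pair[OF finite_part \<open>v \<noteq> w\<close> t, of x F n z] assms elim by auto
  qed
  then have "?R \<longlonglongrightarrow> lim_prob F t {v, w}"
    using occ_prob_tendsto[OF F t, of "{v, w}"] by (simp add: filterlim_cong[OF refl refl])
  moreover have "?R \<longlonglongrightarrow> 1
      - (LINT r:{0..t}|lborel. lim_prob (F - {{v, x}}) r {x, w}) / 2
      - (LINT r:{0..t}|lborel. lim_prob (F - {{w, z}}) r {z, v}) / 2"
    using assms by (intro tendsto_intros set_integral_tendsto) auto
  ultimately show ?thesis by (rule LIMSEQ_unique)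
qed

lemma lim_prob_glue:
  assumes "F1 \<subseteq> E" "F2 \<subseteq> E" "F1 \<inter> F2 = {}" "\<Union>F1 \<inter> \<Union>F2 \<subseteq> {v}"
    and S: "finite S" "S \<inter> \<Union>F1 \<subseteq> {v}" and s: "0 \<le> s" "s \<le> 1"
  shows "lim_prob (F1 \<union> F2) s (insert v S) = lim_prob F1 s {v} * lim_prob F2 s (insert v S)"
proof -
  have "occ_prob ((F1 \<union> F2) \<inter> G n) s (insert v S) =
      occ_prob (F1 \<inter> G n) s {v} * occ_prob (F2 \<inter> G n) s (insert v S)" for n
    unfolding Int_Un_distrib2
    using assms finite_part by (intro occ_prob_glue) auto
  then have "(\<lambda>n. occ_prob (F1 \<inter> G n) s {v} * occ_prob (F2 \<inter> G n) s (insert v S))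
      \<longlonglongrightarrow> lim_prob (F1 \<union> F2) s (insert v S)"
    using occ_prob_tendsto[OF _ s, of "F1 \<union> F2" "insert v S"] assms by simp
  moreover have "(\<lambda>n. occ_prob (F1 \<inter> G n) s {v} * occ_prob (F2 \<inter> G n) s (insert v S))
      \<longlonglongrightarrow> lim_prob F1 s {v} * lim_prob F2 s (insert v S)"
    using assms by (intro tendsto_mult occ_prob_tendsto) auto
  ultimately show ?thesis by (rule LIMSEQ_unique)
qed

lemma lim_prob_isolated:
  assumes "v \<notin> \<Union>F"
  shows "lim_prob F s (insert v S) = lim_prob F s S"
  unfolding lim_prob_def using assms occ_prob_isolated[OF finite_part(1), of v F _ s S] by simp

lemma lim_prob_empty: "lim_prob F s {} = 1"
  unfolding lim_prob_def by (simp add: occ_prob_empty limI)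

end

section \<open>Occupation probabilities in forests\<close>

lemma power_over_fact_tendsto: "(\<lambda>d. x ^ d / fact d) \<longlonglongrightarrow> (0::real)"
proof -
  have "x ^ d / fact d = inverse (fact d) *\<^sub>R x ^ d" for d
    by (simp add: divide_inverse mult.commute)
  then show ?thesis
    using summable_LIMSEQ_zero[OF summable_exp_generic[of x]] by simp
qed

definition connected_in :: "'a set set \<Rightarrow> ('a \<times> 'a) set" where
  "connected_in F = (adj F)\<^sup>*"

lemma connected_in_sym: "(x, y) \<in> connected_in F \<Longrightarrow> (y, x) \<in> connected_in F"
proof -
  have "sym (adj F)" by (auto simp: sym_def adj_def insert_commute)
  then show "(x, y) \<in> connected_in F \<Longrightarrow> (y, x) \<in> connected_in F"
    unfolding connected_in_def by (meson sym_rtrancl symE)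
qed

lemma connected_in_step: "(x, y) \<in> connected_in F \<Longrightarrow> {y, z} \<in> F \<Longrightarrow> (x, z) \<in> connected_in F"
  unfolding connected_in_def by (erule rtrancl_into_rtrancl) (simp add: adj_def)

lemma connected_in_trans: "(x, y) \<in> connected_in F \<Longrightarrow> (y, z) \<in> connected_in F \<Longrightarrow> (x, z) \<in> connected_in F"
  unfolding connected_in_def by (rule rtrancl_trans)

lemma connected_in_mono: "F \<subseteq> F' \<Longrightarrow> (x, y) \<in> connected_in F \<Longrightarrow> (x, y) \<in> connected_in F'"
  unfolding connected_in_def by (erule set_mp[OF rtrancl_mono, rotated]) (auto simp: adj_def)

definition path_in :: "'a set set \<Rightarrow> 'a list \<Rightarrow> bool" where
  "path_in F xs \<longleftrightarrow> distinct xs \<and> successively (\<lambda>x y. {x, y} \<in> F) xs"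

lemma path_in_rev: "path_in F (rev xs) \<longleftrightarrow> path_in F xs"
proof -
  have "(\<lambda>x y. {y, x} \<in> F) = (\<lambda>x y. {x, y} \<in> F)"
    by (intro ext arg_cong[where f="\<lambda>e. e \<in> F"]) (rule insert_commute)
  then have "successively (\<lambda>x y. {y, x} \<in> F) xs = successively (\<lambda>x y. {x, y} \<in> F) xs"
    by (rule arg_cong)
  then show ?thesis by (simp only: path_in_def successively_rev distinct_rev)
qed

lemma path_in_avoid:
  assumes "path_in F (v # xs)" "v \<in> e"
  shows "path_in (F - {e}) xs"
proof -
  have *: "distinct xs" "v \<notin> set xs" "successively (\<lambda>x y. {x, y} \<in> F) xs"
    using assms(1) by (auto simp: path_in_def successively_Cons)
  have "successively (\<lambda>x y. {x, y} \<in> F - {e}) xs"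
  proof (rule successively_mono[OF *(3)])
    fix x y assume "x \<in> set xs" "y \<in> set xs" "{x, y} \<in> F"
    then show "{x, y} \<in> F - {e}" using assms(2) *(2) by auto
  qed
  with *(1) show ?thesis by (simp add: path_in_def)
qed

lemma path_in_connected:
  assumes "successively (\<lambda>x y. {x, y} \<in> F) (v # xs)" "p \<in> set (v # xs)"
  shows "(v, p) \<in> connected_in F"
  using assms
proof (induction xs arbitrary: v)
  case (Cons x xs)
  show ?case
  proof (cases "p = v")
    case False
    with Cons have "(x, p) \<in> connected_in F" by auto
    moreover have "(v, x) \<in> connected_in F"
      using connected_in_step[of v v F x] Cons.prems by (simp add: connected_in_def)
    ultimately show ?thesis by (rule connected_in_trans[rotated])
  qed (simp add: connected_in_def)
qed (simp add: connected_in_def)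

text \<open>The integral equations of the root probability \<open>\<beta>\<close> and of the probability \<open>f m\<close> that both end
  leaves of a path of length \<open>m\<close> are occupied.\<close>

locale limit_laws =
  fixes k :: nat and \<beta> :: "real \<Rightarrow> real" and f :: "nat \<Rightarrow> real \<Rightarrow> real"
  assumes k: "1 \<le> k"
    and \<beta>_cont: "continuous_on {0..1} \<beta>"
    and \<beta>_bounds: "0 \<le> s \<Longrightarrow> s \<le> 1 \<Longrightarrow> 0 \<le> \<beta> s \<and> \<beta> s \<le> 1"
    and \<beta>_eq: "0 \<le> s \<Longrightarrow> s \<le> 1 \<Longrightarrow> \<beta> s = 1 - (LINT r:{0..s}|lborel. \<beta> r ^ k) / 2"
    and f_one: "0 \<le> s \<Longrightarrow> s \<le> 1 \<Longrightarrow> f (Suc 0) s = 1 - s"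
    and f_Suc: "0 \<le> s \<Longrightarrow> s \<le> 1 \<Longrightarrow> 1 \<le> m \<Longrightarrow>
      f (Suc m) s = 1 - (LINT r:{0..s}|lborel. \<beta> r ^ (k - 1) * f m r)"

text \<open>Absence of cycles is used in the form that every edge is a bridge. The sets \<open>F \<subseteq> E\<close> obtained by
  deleting edges inherit this property, so the same statements apply to a tree and to its pieces.\<close>

locale annihilation_forest = annihilation_limit M E \<tau> \<kappa> "k + 1" G + limit_laws k \<beta> f
  for M :: "'\<omega> measure" and E :: "'a set set" and \<tau> \<kappa> k G \<beta> f +
  assumes bridge: "{v, y} \<in> E \<Longrightarrow> (y, v) \<notin> connected_in (E - {{v, y}})"
begin

lemma edgeE:
  assumes "e \<in> E" "v \<in> e"
  obtains y where "e = {v, y}" "y \<noteq> v"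
proof -
  obtain a b where "e = {a, b}" "a \<noteq> b" using card_edge[OF assms(1)] by (auto simp: card_2_iff)
  with assms(2) that show ?thesis by (metis insertE insert_commute singletonD)
qed

lemma finite_incident_subset: "F \<subseteq> E \<Longrightarrow> finite {e\<in>F. v \<in> e}"
  by (rule finite_subset[OF _ finite_incident[of v]]) auto

lemma degree_zero: "F \<subseteq> E \<Longrightarrow> degree F v = 0 \<Longrightarrow> v \<notin> \<Union>F"
  using finite_incident_subset[of F v] by (auto simp: degree_def)

lemma degree_remove: "F \<subseteq> E \<Longrightarrow> e \<in> F \<Longrightarrow> v \<in> e \<Longrightarrow> degree F v = Suc (degree (F - {e}) v)"
proof -
  assume *: "F \<subseteq> E" "e \<in> F" "v \<in> e"
  have "{f\<in>F. v \<in> f} = insert e {f\<in>F - {e}. v \<in> f}" using * by auto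
  then show ?thesis
    using finite_incident_subset[of "F - {e}" v] * unfolding degree_def by (simp add: subset_iff)
qed

lemma degree_other: "v \<notin> e \<Longrightarrow> degree (F - {e}) v = degree F v"
  unfolding degree_def by (rule arg_cong[where f=card]) auto

lemma degree_one: "F \<subseteq> E \<Longrightarrow> e \<in> F \<Longrightarrow> v \<in> e \<Longrightarrow> degree F v = 1 \<Longrightarrow> v \<notin> \<Union>(F - {e})"
  using degree_remove[of F e v] degree_zero[of "F - {e}" v] by auto

lemma degree_pos_edge:
  assumes "F \<subseteq> E" "degree F v \<noteq> 0"
  obtains y where "{v, y} \<in> F"
proof -
  have "{e\<in>F. v \<in> e} \<noteq> {}" using assms(2) unfolding degree_def by (metis card.empty)
  then obtain e where e: "e \<in> F" "v \<in> e" by blast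
  then obtain y where "e = {v, y}" using edgeE[of e v] assms(1) by blast
  with e(1) that show thesis by blast
qed

definition regular_except :: "'a set set \<Rightarrow> 'a set \<Rightarrow> bool" where
  "regular_except F S \<longleftrightarrow> F \<subseteq> E \<and> (\<forall>x\<in>\<Union>F - S. degree F x = k + 1)"

text \<open>The branch \<open>F1\<close> behind the edge \<open>{v, y}\<close> consists of this edge and the component of \<open>y\<close> that is left
  after its removal; since the edge is a bridge, that component avoids \<open>v\<close>.\<close>

lemma branch_split:
  assumes F: "F \<subseteq> E" and e: "{v, y} \<in> F"
  obtains F1 F2 where "F = F1 \<union> F2" "F1 \<inter> F2 = {}" "\<Union>F1 \<inter> \<Union>F2 \<subseteq> {v}" "{v, y} \<in> F1"
    "degree F1 v = 1" "degree F v = Suc (degree F2 v)"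
    "\<And>x. x \<in> \<Union>F1 \<Longrightarrow> x \<noteq> v \<Longrightarrow> degree F1 x = degree F x"
    "\<And>x. x \<in> \<Union>F2 \<Longrightarrow> x \<noteq> v \<Longrightarrow> degree F2 x = degree F x"
    "\<And>x. (v, x) \<in> connected_in (F - {{v, y}}) \<Longrightarrow> x \<in> \<Union>F1 \<Longrightarrow> x = v"
    "\<And>f x. f \<in> F \<Longrightarrow> f \<noteq> {v, y} \<Longrightarrow> x \<in> f \<Longrightarrow> (v, x) \<in> connected_in (F - {{v, y}}) \<Longrightarrow> f \<in> F2"
proof -
  let ?e = "{v, y}"
  define C where "C = {x. (y, x) \<in> connected_in (F - {?e})}"
  define F1 where "F1 = insert ?e {g\<in>F. g \<noteq> ?e \<and> g \<inter> C \<noteq> {}}"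
  define F2 where "F2 = F - F1"
  have yC: "y \<in> C" by (simp add: C_def connected_in_def)
  have vC: "v \<notin> C"
    using bridge[of v y] connected_in_mono[of "F - {?e}" "E - {?e}" y v] F e by (auto simp: C_def)
  have closed: "g \<subseteq> C" if g: "g \<in> F" "g \<noteq> ?e" "a \<in> g" "a \<in> C" for g a
  proof -
    obtain b where b: "g = {a, b}" using edgeE[of g a] g F by blast
    then have "b \<in> C" using g connected_in_step[of y a "F - {?e}" b] by (simp add: C_def)
    with b g show ?thesis by simp
  qed
  have F1C: "\<Union>F1 \<subseteq> insert v C" using closed yC by (auto simp: F1_def)
  have F2C: "\<Union>F2 \<inter> C = {}" by (auto simp: F1_def F2_def)
  have U: "F = F1 \<union> F2" "F1 \<inter> F2 = {}" using e by (auto simp: F1_def F2_def)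
  have v1: "{g\<in>F1. v \<in> g} = {?e}" using closed vC by (auto simp: F1_def)
  show thesis
  proof
    show "F = F1 \<union> F2" "F1 \<inter> F2 = {}" by fact+
    show "\<Union>F1 \<inter> \<Union>F2 \<subseteq> {v}" using F1C F2C by blast
    show "?e \<in> F1" by (simp add: F1_def)
    show "degree F1 v = 1" by (simp add: degree_def v1)
    have "{g\<in>F2. v \<in> g} = {g\<in>F - {?e}. v \<in> g}" using v1 U by auto
    then show "degree F v = Suc (degree F2 v)"
      using degree_remove[OF F e, of v] by (simp add: degree_def)
    show "degree F1 x = degree F x" if "x \<in> \<Union>F1" "x \<noteq> v" for x
    proof -
      have "x \<in> C" using that F1C by auto
      then have "{g\<in>F1. x \<in> g} = {g\<in>F. x \<in> g}" using e by (auto simp: F1_def)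
      then show ?thesis by (simp add: degree_def)
    qed
    show "degree F2 x = degree F x" if "x \<in> \<Union>F2" "x \<noteq> v" for x
    proof -
      have "x \<notin> C" using that F2C by auto
      then have "x \<notin> \<Union>F1" using F1C that by auto
      then have "{g\<in>F2. x \<in> g} = {g\<in>F. x \<in> g}" using U by auto
      then show ?thesis by (simp add: degree_def)
    qed
    have away: "x \<notin> C" if "(v, x) \<in> connected_in (F - {?e})" for x
      using connected_in_trans[OF _ connected_in_sym[OF that], of y] vC by (auto simp: C_def)
    then show "x = v" if "(v, x) \<in> connected_in (F - {?e})" "x \<in> \<Union>F1" for x
      using that F1C by auto
    show "g \<in> F2" if "g \<in> F" "g \<noteq> ?e" "x \<in> g" "(v, x) \<in> connected_in (F - {?e})" for g x
      using that away closed by (auto simp: F2_def F1_def)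
  qed
qed

lemma regular_branch:
  assumes "regular_except F {v}" "{v, y} \<in> F" "degree F v = 1"
  shows "regular_except (F - {{v, y}}) {y}" "degree (F - {{v, y}}) y = k" "v \<notin> \<Union>(F - {{v, y}})"
proof -
  have F: "F \<subseteq> E" using assms by (simp add: regular_except_def)
  then have "y \<noteq> v" using card2_other[of v y] assms by auto
  show v: "v \<notin> \<Union>(F - {{v, y}})" using degree_one[OF F assms(2)] assms by auto
  show "degree (F - {{v, y}}) y = k"
  proof -
    have "y \<in> \<Union>F - {v}" using assms(2) \<open>y \<noteq> v\<close> by auto
    then show ?thesis
      using degree_remove[OF F assms(2), of y] assms(1) by (simp add: regular_except_def)
  qed
  show "regular_except (F - {{v, y}}) {y}"
    unfolding regular_except_def
  proof (intro conjI ballI)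
    fix x assume x: "x \<in> \<Union>(F - {{v, y}}) - {y}"
    then have "x \<noteq> v" "x \<notin> {v, y}" using v by auto
    then show "degree (F - {{v, y}}) x = k + 1"
      using degree_other[of x "{v, y}" F] assms(1) x by (auto simp: regular_except_def)
  qed (use F in auto)
qed

text \<open>Uniqueness for the integral equation, by Picard iteration: if all rooted trees satisfy the bound of
  order \<open>d\<close>, then integrating the leaf equation once gives the bound of order \<open>d + 1\<close>. The equation for one tree
  involves others, so the bound is proved for all of them at the same time.\<close>

lemma lim_prob_root_approx:
  shows "regular_except F {v} \<Longrightarrow> degree F v = a \<Longrightarrow> 0 \<le> s \<Longrightarrow> s \<le> 1 \<Longrightarrow>
    \<bar>lim_prob F s {v} - \<beta> s ^ a\<bar> \<le> real a * ((k / 2 * s) ^ d / fact d)"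
proof (induction d arbitrary: F v a s)
  case 0
  have F: "F \<subseteq> E" using 0 by (simp add: regular_except_def)
  show ?case
  proof (cases "a = 0")
    case True
    then have "lim_prob F s {v} = 1"
      using lim_prob_isolated[of v F s "{}"] lim_prob_empty degree_zero[OF F] 0 by simp
    with True show ?thesis by simp
  next
    case False
    have "\<bar>lim_prob F s {v} - \<beta> s ^ a\<bar> \<le> 1"
    proof -
      have "0 \<le> \<beta> s ^ a" "\<beta> s ^ a \<le> 1" using \<beta>_bounds[OF 0(3,4)] by (simp_all add: power_le_one)
      then show ?thesis
        using lim_prob_bounds[OF F 0(3,4), of "{v}"] unfolding abs_le_iff by auto
    qed
    with False show ?thesis by simp
  qed
next
  case (Suc d)
  note s = Suc.prems(3,4)
  define \<epsilon> where "\<epsilon> = (k / 2 * s) ^ Suc d / fact (Suc d)"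
  have \<epsilon>0: "0 \<le> \<epsilon>" using s by (simp add: \<epsilon>_def)
  have branch: "\<bar>lim_prob F s {v} - \<beta> s\<bar> \<le> \<epsilon>" if reg: "regular_except F {v}" "degree F v = 1" for F v
  proof -
    have F: "F \<subseteq> E" using reg by (simp add: regular_except_def)
    obtain y where y: "{v, y} \<in> F" using degree_pos_edge[OF F, of v] reg(2) by auto
    note rb = regular_branch[OF reg(1) y reg(2)]
    let ?p = "\<lambda>r. lim_prob (F - {{v, y}}) r {y}"
    have F': "F - {{v, y}} \<subseteq> E" using F by auto
    have int_p: "set_integrable lborel {0..s} ?p"
      by (rule set_integral_tendsto(2)[OF F' s]) simp
    have int_\<beta>: "set_integrable lborel {0..s} (\<lambda>r. \<beta> r ^ k)"
      using s by (intro borel_integrable_atLeastAtMost' continuous_intros continuous_on_subset[OF \<beta>_cont]) auto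
    have "lim_prob F s {v} - \<beta> s = ((LINT r:{0..s}|lborel. \<beta> r ^ k) - (LINT r:{0..s}|lborel. ?p r)) / 2"
      using lim_prob_leaf[OF F y rb(3) s] \<beta>_eq[OF s] by (simp add: field_simps)
    also have "\<dots> = (LINT r:{0..s}|lborel. \<beta> r ^ k - ?p r) / 2"
      using int_p int_\<beta> by (simp add: set_integral_diff)
    finally have "\<bar>lim_prob F s {v} - \<beta> s\<bar> = \<bar>LINT r:{0..s}|lborel. \<beta> r ^ k - ?p r\<bar> / 2"
      by (simp only: abs_divide abs_numeral)
    also have "\<dots> \<le> (LINT r:{0..s}|lborel. \<bar>\<beta> r ^ k - ?p r\<bar>) / 2"
      using set_integral_norm_bound[OF set_integral_diff(1)[OF int_\<beta> int_p]] by simp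
    also have "\<dots> \<le> (LINT r:{0..s}|lborel. real k * ((k / 2 * r) ^ d / fact d)) / 2"
    proof (intro divide_right_mono set_integral_mono)
      show "set_integrable lborel {0..s} (\<lambda>r. \<bar>\<beta> r ^ k - ?p r\<bar>)"
        by (intro set_integrable_abs set_integral_diff int_\<beta> int_p)
      show "set_integrable lborel {0..s} (\<lambda>r. real k * ((k / 2 * r) ^ d / fact d))"
        using s by (intro set_integrable_mult_right LINT_power_over_fact)
      show "\<bar>\<beta> r ^ k - ?p r\<bar> \<le> real k * ((k / 2 * r) ^ d / fact d)" if "r \<in> {0..s}" for r
        using Suc.IH[OF rb(1,2), of r] that s by (simp add: abs_minus_commute)
    qed simp
    also have "\<dots> = (k / 2) * (LINT r:{0..s}|lborel. (k / 2 * r) ^ d / fact d)"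
      by simp
    also have "\<dots> = \<epsilon>"
      unfolding \<epsilon>_def using s by (intro LINT_power_over_fact)
    finally show ?thesis .
  qed
  have "\<bar>lim_prob F s {v} - \<beta> s ^ a\<bar> \<le> real a * \<epsilon>"
    if "regular_except F {v}" "degree F v = a" for F v a
    using that
  proof (induction a arbitrary: F)
    case 0
    then have "lim_prob F s {v} = 1"
      using lim_prob_isolated[of v F s "{}"] lim_prob_empty degree_zero[of F v]
      by (simp add: regular_except_def)
    then show ?case by simp
  next
    case (Suc a)
    have F: "F \<subseteq> E" using Suc by (simp add: regular_except_def)
    obtain y where y: "{v, y} \<in> F" using degree_pos_edge[OF F, of v] Suc.prems(2) by auto
    obtain F1 F2 where sp: "F = F1 \<union> F2" "F1 \<inter> F2 = {}" "\<Union>F1 \<inter> \<Union>F2 \<subseteq> {v}"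
      "degree F1 v = 1" "degree F v = Suc (degree F2 v)"
      "\<And>x. x \<in> \<Union>F1 \<Longrightarrow> x \<noteq> v \<Longrightarrow> degree F1 x = degree F x"
      "\<And>x. x \<in> \<Union>F2 \<Longrightarrow> x \<noteq> v \<Longrightarrow> degree F2 x = degree F x"
      by (rule branch_split[OF F y]) blast
    have reg: "regular_except F1 {v}" "regular_except F2 {v}"
      using Suc.prems(1) sp(1) F unfolding regular_except_def by (auto simp: sp(6,7))
    have p: "lim_prob F s {v} = lim_prob F1 s {v} * lim_prob F2 s {v}"
      unfolding sp(1) using sp F s by (intro lim_prob_glue[where S="{}"]) auto
    have 1: "\<bar>lim_prob F1 s {v} - \<beta> s\<bar> \<le> \<epsilon>" by (rule branch[OF reg(1) sp(4)])
    have 2: "\<bar>lim_prob F2 s {v} - \<beta> s ^ a\<bar> \<le> real a * \<epsilon>"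
      using Suc.IH[OF reg(2)] sp(5) Suc.prems(2) by simp
    have b2: "\<bar>lim_prob F2 s {v}\<bar> \<le> 1"
      using lim_prob_bounds[of F2 s "{v}"] sp(1) F s by auto
    have "lim_prob F s {v} - \<beta> s ^ Suc a =
        (lim_prob F1 s {v} - \<beta> s) * lim_prob F2 s {v} + \<beta> s * (lim_prob F2 s {v} - \<beta> s ^ a)"
      unfolding p by (simp add: algebra_simps)
    also have "\<bar>\<dots>\<bar> \<le> \<bar>lim_prob F1 s {v} - \<beta> s\<bar> * \<bar>lim_prob F2 s {v}\<bar> + \<bar>\<beta> s\<bar> * \<bar>lim_prob F2 s {v} - \<beta> s ^ a\<bar>"
      by (metis abs_mult abs_triangle_ineq)
    also have "\<dots> \<le> \<epsilon> * 1 + 1 * (real a * \<epsilon>)"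
      using 1 2 b2 \<epsilon>0 \<beta>_bounds[OF s] by (intro add_mono mult_mono) auto
    finally show ?case by (simp add: algebra_simps)
  qed
  from this[OF Suc.prems(1,2)] show ?case by (simp add: \<epsilon>_def)
qed

theorem lim_prob_root:
  assumes "regular_except F {v}" "0 \<le> s" "s \<le> 1"
  shows "lim_prob F s {v} = \<beta> s ^ degree F v"
proof -
  have "(\<lambda>d. real (degree F v) * ((k / 2 * s) ^ d / fact d)) \<longlonglongrightarrow> 0"
    by (intro tendsto_mult_right_zero power_over_fact_tendsto)
  then have "\<bar>lim_prob F s {v} - \<beta> s ^ degree F v\<bar> \<le> 0"
    by (rule LIMSEQ_le_const) (use lim_prob_root_approx[OF assms(1) refl assms(2,3)] in blast)
  then show ?thesis by simp
qed

text \<open>The ends of the path have \<open>a\<close> and \<open>b\<close> neighbours off the path.\<close>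

definition pair_law :: "nat \<Rightarrow> bool" where
  "pair_law m \<longleftrightarrow> (\<forall>F xs a b s. regular_except F {hd xs, last xs} \<longrightarrow> path_in F xs \<longrightarrow> length xs = Suc m \<longrightarrow>
     degree F (hd xs) = Suc a \<longrightarrow> degree F (last xs) = Suc b \<longrightarrow> 0 \<le> s \<longrightarrow> s \<le> 1 \<longrightarrow>
     lim_prob F s {hd xs, last xs} = \<beta> s ^ (a + b) * f m s)"

text \<open>Deleting the edge at the leaf \<open>v\<close> leaves a path that is shorter by one, whose new end \<open>x\<close> has \<open>k - 1\<close>
  neighbours off the path.\<close>

lemma pair_leaf_step:
  assumes IH: "pair_law m" "1 \<le> m"
    and reg: "regular_except F {v, w}" and path: "path_in F (v # x # xs)"
    and len: "length xs = m" and w: "w = last (x # xs)"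
    and deg: "degree F v = 1" "degree F w = 1" and s: "0 \<le> s" "s \<le> 1"
  shows "lim_prob (F - {{v, x}}) s {x, w} = \<beta> s ^ (k - 1) * f m s"
proof -
  let ?e = "{v, x}"
  have F: "F \<subseteq> E" using reg by (simp add: regular_except_def)
  have e: "?e \<in> F" using path by (simp add: path_in_def)
  have vx: "v \<noteq> x" "v \<notin> set xs" "x \<notin> set xs" using path by (auto simp: path_in_def)
  have "w \<in> set xs" using w len IH(2) by (cases xs) auto
  then have wv: "w \<noteq> v" "w \<noteq> x" using vx by auto
  have v: "v \<notin> \<Union>(F - {?e})" using degree_one[OF F e _ deg(1)] by auto
  have dx: "degree F x = k + 1"
    using reg e vx wv unfolding regular_except_def by blast
  have reg': "regular_except (F - {?e}) {x, w}"
    unfolding regular_except_def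
  proof (intro conjI ballI)
    fix y assume y: "y \<in> \<Union>(F - {?e}) - {x, w}"
    then have "y \<noteq> v" using v by auto
    then show "degree (F - {?e}) y = k + 1"
      using degree_other[of y ?e F] reg y by (auto simp: regular_except_def)
  qed (use F in auto)
  have d1: "degree (F - {?e}) x = Suc (k - 1)"
    using degree_remove[OF F e, of x] dx k by simp
  have d2: "degree (F - {?e}) w = Suc 0"
    using degree_other[of w ?e F] wv deg by simp
  have "path_in (F - {?e}) (x # xs)" by (rule path_in_avoid[OF path]) simp
  then have "lim_prob (F - {?e}) s {hd (x # xs), last (x # xs)} = \<beta> s ^ ((k - 1) + 0) * f m s"
    using IH(1) reg' d1 d2 s len w unfolding pair_law_def
    by (metis length_Cons list.sel(1))
  then show ?thesis using w by simp
qed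

lemma pair_leaves_base:
  assumes reg: "regular_except F {v, w}" and path: "path_in F [v, w]"
    and deg: "degree F v = 1" "degree F w = 1" and s: "0 \<le> s" "s \<le> 1"
  shows "lim_prob F s {v, w} = 1 - s"
proof -
  have F: "F \<subseteq> E" using reg by (simp add: regular_except_def)
  have e: "{v, w} \<in> F" "v \<noteq> w" using path by (auto simp: path_in_def)
  have v: "v \<notin> \<Union>(F - {{v, w}})" using degree_one[OF F e(1) _ deg(1)] by auto
  have w: "w \<notin> \<Union>(F - {{v, w}})" using degree_one[OF F e(1) _ deg(2)] by auto
  have one: "lim_prob (F - {{v, w}}) r {w, w} = 1" "lim_prob (F - {{v, w}}) r {v, v} = 1" for r
    using lim_prob_isolated[OF w, of r "{}"] lim_prob_isolated[OF v, of r "{}"] lim_prob_empty by auto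
  have "{w, v} = {v, w}" by auto
  then have "lim_prob F s {v, w} = 1
    - (LINT r:{0..s}|lborel. lim_prob (F - {{v, w}}) r {w, w}) / 2
    - (LINT r:{0..s}|lborel. lim_prob (F - {{v, w}}) r {v, v}) / 2"
    using lim_prob_leaf_pair[OF F e(2) s e(1) v, of v] e w by simp
  moreover have "(LINT r:{0..s}|lborel. (1::real)) = s"
    using s by (simp add: set_lebesgue_integral_def)
  ultimately show ?thesis unfolding one by simp
qed

lemma pair_leaves:
  assumes IH: "1 < m \<Longrightarrow> pair_law (m - 1)"
    and m: "1 \<le> m" and reg: "regular_except F {hd xs, last xs}" and path: "path_in F xs"
    and len: "length xs = Suc m"
    and deg: "degree F (hd xs) = 1" "degree F (last xs) = 1" and s: "0 \<le> s" "s \<le> 1"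
  shows "lim_prob F s {hd xs, last xs} = f m s"
proof (cases "m = 1")
  case True
  then obtain v w where xs: "xs = [v, w]" using len by (auto simp: length_Suc_conv)
  have "lim_prob F s {v, w} = 1 - s"
    using pair_leaves_base[of F v w s] reg path deg s xs by simp
  then show ?thesis using True f_one[OF s] xs by simp
next
  case False
  define n where "n = m - 1"
  have n: "1 \<le> n" "m = Suc n" using False m by (auto simp: n_def)
  have IH': "pair_law n" using IH False m by (simp add: n_def)
  obtain v x ys where xs: "xs = v # x # ys" "length ys = n"
    using len n by (auto simp: length_Suc_conv)
  obtain w z zs where rxs: "rev xs = w # z # zs" "length zs = n"
    using len n length_rev[of xs] by (metis length_Suc_conv)
  have w: "last xs = w" "w = last (x # ys)"
    using rxs xs by (metis hd_rev list.sel(1), metis hd_rev last_ConsR list.distinct(1) list.sel(1))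
  have hv: "v = last (z # zs)"
    using rxs xs by (metis last_ConsR last_rev list.distinct(1) list.sel(1))
  have F: "F \<subseteq> E" using reg by (simp add: regular_except_def)
  have path': "path_in F (w # z # zs)" using path path_in_rev[of F xs] rxs by simp
  have vw: "v \<noteq> w"
    using path w(2) xs by (auto simp: path_in_def)
  have reg1: "regular_except F {v, w}" using reg xs w by simp
  then have reg2: "regular_except F {w, v}" by (simp add: insert_commute)
  have deg': "degree F v = 1" "degree F w = 1" using deg xs w by auto
  have e: "{v, x} \<in> F" using path xs by (simp add: path_in_def)
  have e': "{w, z} \<in> F" using path' by (simp add: path_in_def)
  have nv: "v \<notin> \<Union>(F - {{v, x}})" using degree_one[OF F e _ deg'(1)] by auto
  have nw: "w \<notin> \<Union>(F - {{w, z}})" using degree_one[OF F e' _ deg'(2)] by auto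
  have 1: "lim_prob (F - {{v, x}}) r {x, w} = \<beta> r ^ (k - 1) * f n r" if "r \<in> {0..s}" for r
    using pair_leaf_step[OF IH' n(1) reg1 _ xs(2) w(2) deg', of r] path xs that s by simp
  have 2: "lim_prob (F - {{w, z}}) r {z, v} = \<beta> r ^ (k - 1) * f n r" if "r \<in> {0..s}" for r
    using pair_leaf_step[OF IH' n(1) reg2 path' rxs(2) hv deg'(2,1), of r] that s by simp
  have "lim_prob F s {v, w} = 1
    - (LINT r:{0..s}|lborel. lim_prob (F - {{v, x}}) r {x, w}) / 2
    - (LINT r:{0..s}|lborel. lim_prob (F - {{w, z}}) r {z, v}) / 2"
    by (rule lim_prob_leaf_pair[OF F vw s e nv e' nw])
  also have "(LINT r:{0..s}|lborel. lim_prob (F - {{v, x}}) r {x, w}) =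
      (LINT r:{0..s}|lborel. \<beta> r ^ (k - 1) * f n r)"
    using 1 by (intro set_lebesgue_integral_cong) auto
  also have "(LINT r:{0..s}|lborel. lim_prob (F - {{w, z}}) r {z, v}) =
      (LINT r:{0..s}|lborel. \<beta> r ^ (k - 1) * f n r)"
    using 2 by (intro set_lebesgue_integral_cong) auto
  finally show ?thesis
    using f_Suc[OF s n(1)] n(2) xs w by simp
qed

text \<open>Split off one branch at the first end; the path stays on the other side of the split.\<close>

lemma pair_peel:
  assumes reg: "regular_except F {hd xs, last xs}" and path: "path_in F xs"
    and len: "length xs = Suc m" "1 \<le> m"
    and deg: "degree F (hd xs) = Suc (Suc a)" and s: "0 \<le> s" "s \<le> 1"
  obtains F' where "regular_except F' {hd xs, last xs}" "path_in F' xs"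
    "degree F' (hd xs) = Suc a" "degree F' (last xs) = degree F (last xs)"
    "lim_prob F s {hd xs, last xs} = \<beta> s * lim_prob F' s {hd xs, last xs}"
proof -
  obtain v x ys where xs: "xs = v # x # ys" using len by (auto simp: length_Suc_conv Suc_le_eq gr0_conv_Suc)
  define w where "w = last xs"
  have F: "F \<subseteq> E" using reg by (simp add: regular_except_def)
  have e0: "{v, x} \<in> F" using path xs by (simp add: path_in_def)
  have dist: "v \<noteq> x" "v \<notin> set ys" using path xs by (auto simp: path_in_def)
  have wset: "w \<in> set (x # ys)" unfolding w_def xs by (metis last.simps last_in_set list.distinct(1))
  then have vw: "w \<noteq> v" using dist by auto
  have "\<not> {e\<in>F. v \<in> e} \<subseteq> {{v, x}}"
  proof
    assume "{e\<in>F. v \<in> e} \<subseteq> {{v, x}}"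
    then have "degree F v \<le> card {{v, x}}"
      unfolding degree_def by (intro card_mono) auto
    with deg xs show False by simp
  qed
  then obtain g where g: "g \<in> F" "v \<in> g" "g \<noteq> {v, x}" by auto
  then obtain y where "g = {v, y}" using edgeE[of g v] F by blast
  with g have y: "{v, y} \<in> F" "{v, y} \<noteq> {v, x}" by auto
  let ?e = "{v, y}"
  have p0: "path_in (F - {?e}) (x # ys)"
    by (rule path_in_avoid[of F v]) (use path xs in auto)
  then have p1: "path_in (F - {?e}) xs" using path e0 y xs by (auto simp: path_in_def)
  have conn: "(v, p) \<in> connected_in (F - {?e})" if "p \<in> set xs" for p
    using path_in_connected[of "F - {?e}" v "x # ys" p] p1 xs that by (simp add: path_in_def)
  obtain F1 F2 where sp: "F = F1 \<union> F2" "F1 \<inter> F2 = {}" "\<Union>F1 \<inter> \<Union>F2 \<subseteq> {v}"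
      "degree F1 v = 1" "degree F v = Suc (degree F2 v)"
      "\<And>x. x \<in> \<Union>F1 \<Longrightarrow> x \<noteq> v \<Longrightarrow> degree F1 x = degree F x"
      "\<And>x. x \<in> \<Union>F2 \<Longrightarrow> x \<noteq> v \<Longrightarrow> degree F2 x = degree F x"
      "\<And>x. (v, x) \<in> connected_in (F - {?e}) \<Longrightarrow> x \<in> \<Union>F1 \<Longrightarrow> x = v"
      "\<And>f x. f \<in> F \<Longrightarrow> f \<noteq> ?e \<Longrightarrow> x \<in> f \<Longrightarrow> (v, x) \<in> connected_in (F - {?e}) \<Longrightarrow> f \<in> F2"
    by (rule branch_split[OF F y(1)]) blast
  have wF1: "w \<notin> \<Union>F1" using sp(8)[of w] conn[of w] wset xs vw by auto
  have reg1: "regular_except F1 {v}"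
    unfolding regular_except_def
  proof (intro conjI ballI)
    fix u assume u: "u \<in> \<Union>F1 - {v}"
    then have "u \<noteq> w" using wF1 by auto
    then show "degree F1 u = k + 1"
      using sp(1,6) u reg xs w_def by (auto simp: regular_except_def)
  qed (use F sp(1) in auto)
  have p2: "path_in F2 xs"
    unfolding path_in_def
  proof
    show "successively (\<lambda>x y. {x, y} \<in> F2) xs"
    proof (rule successively_mono)
      show "successively (\<lambda>x y. {x, y} \<in> F - {?e}) xs" using p1 by (simp add: path_in_def)
      show "{p, q} \<in> F2" if "p \<in> set xs" "{p, q} \<in> F - {?e}" for p q
        using sp(9)[of "{p, q}" p] conn[OF that(1)] that(2) by simp
    qed
  qed (use path in \<open>simp add: path_in_def\<close>)
  have w2: "w \<in> \<Union>F2"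
  proof -
    obtain q where "{q, w} \<in> F2"
    proof -
      have "xs = butlast xs @ [w]" "butlast xs \<noteq> []" using xs w_def by auto
      then have "{last (butlast xs), w} \<in> F2"
        using p2 unfolding path_in_def by (metis successively_append_iff list.sel(1) list.distinct(1))
      then show thesis by (rule that)
    qed
    then show ?thesis by auto
  qed
  have reg2: "regular_except F2 {v, w}"
    using reg sp(1,7) F xs w_def unfolding regular_except_def by auto
  have "lim_prob F s {v, w} = lim_prob F1 s {v} * lim_prob F2 s {v, w}"
    unfolding sp(1) using sp F s wF1 by (intro lim_prob_glue) auto
  also have "lim_prob F1 s {v} = \<beta> s"
    using lim_prob_root[OF reg1 s] sp(4) by simp
  finally have "lim_prob F s {v, w} = \<beta> s * lim_prob F2 s {v, w}" .
  then show thesis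
    using that[of F2] reg2 p2 sp(5) sp(7)[OF w2 vw] deg xs w_def by simp
qed

theorem pair_law_holds: "1 \<le> m \<Longrightarrow> pair_law m"
proof (induction m rule: less_induct)
  case (less m)
  have "lim_prob F s {hd xs, last xs} = \<beta> s ^ (a + b) * f m s"
    if "regular_except F {hd xs, last xs}" "path_in F xs" "length xs = Suc m"
      "degree F (hd xs) = Suc a" "degree F (last xs) = Suc b" "0 \<le> s" "s \<le> 1" for F xs a b s
    using that
  proof (induction "a + b" arbitrary: F xs a b)
    case 0
    then show ?case
      using pair_leaves[OF _ less.prems, of F xs s] less.IH[of "m - 1"] less.prems by simp
  next
    case (Suc n)
    show ?case
    proof (cases a)
      case (Suc a')
      obtain F' where F': "regular_except F' {hd xs, last xs}" "path_in F' xs"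
        "degree F' (hd xs) = Suc a'" "degree F' (last xs) = degree F (last xs)"
        "lim_prob F s {hd xs, last xs} = \<beta> s * lim_prob F' s {hd xs, last xs}"
        using pair_peel[OF Suc.prems(1-3) less.prems _ Suc.prems(6,7), of a'] Suc.prems(4) Suc by blast
      have "lim_prob F' s {hd xs, last xs} = \<beta> s ^ (a' + b) * f m s"
        using Suc.hyps(1)[of a' b F' xs] Suc.hyps(2) Suc Suc.prems F' by simp
      then show ?thesis using F'(5) Suc by simp
    next
      case 0
      then obtain b' where b': "b = Suc b'" using Suc.hyps(2) by (cases b) auto
      have ne: "xs \<noteq> []" using Suc.prems(3) by auto
      have sym: "{last xs, hd xs} = {hd xs, last xs}" by auto
      obtain F' where F': "regular_except F' {last xs, hd xs}" "path_in F' (rev xs)"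
        "degree F' (last xs) = Suc b'" "degree F' (hd xs) = degree F (hd xs)"
        "lim_prob F s {last xs, hd xs} = \<beta> s * lim_prob F' s {last xs, hd xs}"
        using pair_peel[of F "rev xs" m b' s] Suc.prems less.prems b' ne
        by (auto simp: hd_rev last_rev path_in_rev insert_commute)
      have "lim_prob F' s {hd xs, last xs} = \<beta> s ^ (a + b') * f m s"
        using Suc.hyps(1)[of a b' F' xs] Suc.hyps(2) b' Suc.prems F' unfolding path_in_rev sym by simp
      then show ?thesis using F'(5) b' unfolding sym by simp
    qed
  qed
  then show ?case unfolding pair_law_def by blast
qed

end

section \<open>Solving the integral equations\<close>

lemma LINT_FTC:
  fixes g :: "real \<Rightarrow> real"
  assumes "0 \<le> s" "\<And>x. 0 \<le> x \<Longrightarrow> x \<le> s \<Longrightarrow> (H has_real_derivative g x) (at x)"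
    and "\<And>x. 0 \<le> x \<Longrightarrow> x \<le> s \<Longrightarrow> isCont g x"
  shows "(LINT r:{0..s}|lborel. g r) = H s - H 0"
  using integral_FTC_Icc_real[of 0 s H g] assms
  by (simp add: set_lebesgue_integral_def mult.commute)

text \<open>\<open>L\<close> is the variable in which the recursion for \<open>f\<close> becomes \<open>g (n + 1)' = g n\<close>. The index of \<open>g\<close> is the number of
  inner vertices of the path, one less than its length.\<close>

lemma limit_lawsI:
  fixes B L :: "real \<Rightarrow> real" and g :: "nat \<Rightarrow> real \<Rightarrow> real"
  assumes k: "1 \<le> k"
    and B: "\<And>t. 0 \<le> t \<Longrightarrow> t \<le> 1 \<Longrightarrow> (B has_real_derivative - (B t ^ k) / 2) (at t)"
    and B0: "B 0 = 1" and B01: "\<And>t. 0 \<le> t \<Longrightarrow> t \<le> 1 \<Longrightarrow> 0 \<le> B t \<and> B t \<le> 1"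
    and L: "\<And>t. 0 \<le> t \<Longrightarrow> t \<le> 1 \<Longrightarrow> (L has_real_derivative - (B t ^ (k - 1))) (at t)"
    and L0: "L 0 = 0" and g0: "\<And>t. 0 \<le> t \<Longrightarrow> t \<le> 1 \<Longrightarrow> g 0 (L t) = 1 - t"
    and g_cont: "\<And>x. isCont (g 0) x"
    and g: "\<And>n x. (g (Suc n) has_real_derivative g n x) (at x)" and g1: "\<And>n. g (Suc n) 0 = 1"
  shows "limit_laws k B (\<lambda>m t. g (m - 1) (L t))"
proof
  have Bc: "isCont B t" if "0 \<le> t" "t \<le> 1" for t
    using B[OF that] by (rule DERIV_isCont)
  show "continuous_on {0..1} B"
    by (rule continuous_at_imp_continuous_on) (use Bc in auto)
  show "B s = 1 - (LINT r:{0..s}|lborel. B r ^ k) / 2" if "0 \<le> s" "s \<le> 1" for s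
  proof -
    have "(LINT r:{0..s}|lborel. B r ^ k) = - 2 * B s - (- 2 * B 0)"
    proof (rule LINT_FTC[OF that(1)])
      show "((\<lambda>x. - 2 * B x) has_real_derivative B x ^ k) (at x)" if "0 \<le> x" "x \<le> s" for x
        using DERIV_cmult[OF B[of x], of "- 2"] that \<open>s \<le> 1\<close> by simp
      show "isCont (\<lambda>x. B x ^ k) x" if "0 \<le> x" "x \<le> s" for x
        using Bc[of x] that \<open>s \<le> 1\<close> by (intro continuous_intros) auto
    qed
    then show ?thesis using B0 by (simp add: field_simps)
  qed
  show "g (Suc m - 1) (L s) = 1 - (LINT r:{0..s}|lborel. B r ^ (k - 1) * g (m - 1) (L r))"
    if s: "0 \<le> s" "s \<le> 1" and "1 \<le> m" for s m
  proof -
    obtain n where m: "m = Suc n" using \<open>1 \<le> m\<close> by (cases m) auto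
    have gc: "isCont (g n) x" for x
      using g_cont DERIV_isCont[OF g] by (cases n) auto
    have "(LINT r:{0..s}|lborel. B r ^ (k - 1) * g n (L r)) = - g (Suc n) (L s) - (- g (Suc n) (L 0))"
    proof (rule LINT_FTC[OF s(1)])
      fix x assume x: "0 \<le> x" "x \<le> s"
      have "((\<lambda>x. g (Suc n) (L x)) has_real_derivative g n (L x) * - (B x ^ (k - 1))) (at x)"
        using x s by (intro DERIV_chain2[OF g L]) auto
      from DERIV_minus[OF this]
      show "((\<lambda>x. - g (Suc n) (L x)) has_real_derivative B x ^ (k - 1) * g n (L x)) (at x)"
        by (simp add: mult.commute)
      have "isCont L x" using L[of x] x s by (auto intro: DERIV_isCont)
      then show "isCont (\<lambda>x. B x ^ (k - 1) * g n (L x)) x"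
        using Bc[of x] x s by (intro continuous_intros isCont_o2[OF _ gc]) auto
    qed
    then show ?thesis using m L0 g1 by simp
  qed
qed (use k B01 g0 in auto)

lemma exp_tail_has_sum:
  fixes x :: real
  shows "((\<lambda>j. x ^ j / fact j) has_sum (exp x - (\<Sum>j<n. x ^ j / fact j))) {n..}"
proof -
  have "((\<lambda>j. x ^ j / fact j) has_sum exp x) UNIV"
  proof (rule norm_summable_imp_has_sum)
    show "summable (\<lambda>j. norm (x ^ j / fact j))"
      using summable_norm_exp[of x] by (simp add: divide_inverse mult.commute)
    show "(\<lambda>j. x ^ j / fact j) sums exp x"
      using exp_converges[of x] by (simp add: divide_inverse mult.commute)
  qed
  from has_sum_Diff[OF this has_sum_finite[of "{..<n}"]]
  show ?thesis by (simp add: Compl_lessThan flip: Compl_eq_Diff_UNIV)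
qed

definition exp_partial :: "nat \<Rightarrow> real \<Rightarrow> real" where
  "exp_partial n x = (\<Sum>j<n. x ^ j / fact j)"

lemma exp_partial_deriv: "(exp_partial (Suc n) has_real_derivative exp_partial n x) (at x)"
proof -
  have "((\<lambda>x. \<Sum>j<Suc n. x ^ j / fact j) has_real_derivative (\<Sum>j<Suc n. real j * x ^ (j - 1) / fact j)) (at x)"
    by (intro DERIV_sum) (auto intro!: derivative_eq_intros)
  also have "(\<Sum>j<Suc n. real j * x ^ (j - 1) / fact j) = (\<Sum>j<n. x ^ j / fact j)"
    by (subst sum.lessThan_Suc_shift) (simp add: divide_simps)
  finally show ?thesis unfolding exp_partial_def[abs_def] .
qed

lemma exp_partial_0: "exp_partial (Suc n) 0 = 1"
  unfolding exp_partial_def by (subst sum.lessThan_Suc_shift) simp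

lemma infsum_exp_tail: "(\<Sum>\<^sub>\<infinity>j\<in>{n..}. x ^ j / fact j) = exp x - exp_partial n x"
  using exp_tail_has_sum[of x n] by (simp add: infsumI exp_partial_def)

text \<open>On the line \<open>2 ln \<beta> = - t\<close>, so the successive antiderivatives of \<open>1 - t = 1 + x\<close> with value \<open>1\<close> at \<open>0\<close> are
  the partial sums of \<open>exp x\<close>. For \<open>m \<ge> 1\<close> the index \<open>Suc (Suc (m - 1))\<close> is \<open>m + 1\<close>, that is, the sum
  runs up to the power \<open>m\<close>.\<close>

lemma limit_laws_line:
  "limit_laws 1 (\<lambda>t. exp (- t / 2)) (\<lambda>m t. exp_partial (Suc (Suc (m - 1))) (- t))"
proof (rule limit_lawsI[where g="\<lambda>n. exp_partial (Suc (Suc n))" and L="\<lambda>t. - t"])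
  show "((\<lambda>t. exp (- t / 2)) has_real_derivative - (exp (- t / 2) ^ 1) / 2) (at t)" for t :: real
    by (auto intro!: derivative_eq_intros)
  show "(uminus has_real_derivative - (exp (- t / 2) ^ (1 - 1))) (at t)" for t :: real
    by (auto intro!: derivative_eq_intros)
  show "isCont (exp_partial (Suc (Suc 0))) x" for x
    by (rule DERIV_isCont[OF exp_partial_deriv])
  show "(exp_partial (Suc (Suc (Suc n))) has_real_derivative exp_partial (Suc (Suc n)) x) (at x)" for n x
    by (rule exp_partial_deriv)
  show "exp_partial (Suc (Suc (Suc n))) 0 = 1" for n
    by (rule exp_partial_0)
qed (auto simp: exp_partial_def)

definition tree_beta :: "nat \<Rightarrow> real \<Rightarrow> real" where
  "tree_beta k t = (1 + (real k - 1) * t / 2) powr (- 1 / (real k - 1))"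

text \<open>For \<open>n = 0\<close> and \<open>x = 2 ln \<beta>\<close> the last exponential is \<open>1 + (k - 1) t / 2\<close>, and the value is \<open>1 - t\<close>.
  Each further function is the antiderivative of the preceding one with value \<open>1\<close> at \<open>x = 0\<close>.\<close>

definition tree_pair :: "nat \<Rightarrow> nat \<Rightarrow> real \<Rightarrow> real" where
  "tree_pair k n x = (real k + 1) / (real k - 1) * x ^ n / fact n + exp_partial n x
     + (2 / (1 - real k)) ^ Suc n * (exp ((1 - real k) / 2 * x) - exp_partial n ((1 - real k) / 2 * x))"

lemma tree_pair_deriv:
  assumes "2 \<le> k"
  shows "(tree_pair k (Suc n) has_real_derivative tree_pair k n x) (at x)"
proof -
  define c where "c = (1 - real k) / 2"
  define q where "q = 2 / (1 - real k)"
  define K where "K = (real k + 1) / (real k - 1)"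
  have qc: "q * c = 1" using assms by (simp add: q_def c_def)
  have "((\<lambda>x. exp_partial (Suc n) (c * x)) has_real_derivative exp_partial n (c * x) * c) (at x)"
    by (rule DERIV_chain2[OF exp_partial_deriv]) (auto intro!: derivative_eq_intros)
  moreover have "((\<lambda>x. exp (c * x)) has_real_derivative exp (c * x) * c) (at x)"
    by (auto intro!: derivative_eq_intros)
  moreover have "((\<lambda>x. K * x ^ Suc n / fact (Suc n)) has_real_derivative K * x ^ n / fact n) (at x)"
  proof -
    have "((\<lambda>x. K / fact (Suc n) * x ^ Suc n) has_real_derivative
        K / fact (Suc n) * ((1 + real n) * (1 * x ^ n))) (at x)"
      by (intro DERIV_cmult DERIV_power_Suc DERIV_ident)
    moreover have "K / fact (Suc n) * ((1 + real n) * (1 * x ^ n)) = K * x ^ n / fact n"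
    proof -
      have "fact (Suc n) = (1 + real n) * fact n" "1 + real n \<noteq> 0" by simp_all
      then show ?thesis by (simp only:) (simp del: of_nat_Suc)
    qed
    ultimately show ?thesis by (simp only: times_divide_eq_left)
  qed
  ultimately have "((\<lambda>x. K * x ^ Suc n / fact (Suc n) + exp_partial (Suc n) x
      + q ^ Suc (Suc n) * (exp (c * x) - exp_partial (Suc n) (c * x))) has_real_derivative
      K * x ^ n / fact n + exp_partial n x
      + q ^ Suc (Suc n) * (exp (c * x) * c - exp_partial n (c * x) * c)) (at x)"
    by (intro DERIV_add DERIV_cmult DERIV_diff exp_partial_deriv)
  also have "q ^ Suc (Suc n) * (exp (c * x) * c - exp_partial n (c * x) * c) =
      (q * c) * (q ^ Suc n * (exp (c * x) - exp_partial n (c * x)))"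
    by (simp add: algebra_simps)
  finally show ?thesis
    unfolding tree_pair_def[abs_def] qc by (simp add: q_def c_def K_def)
qed

lemma limit_laws_tree:
  assumes "2 \<le> k"
  shows "limit_laws k (tree_beta k) (\<lambda>m t. tree_pair k (m - 1) (2 * ln (tree_beta k t)))"
proof -
  define u where "u t = 1 + (real k - 1) * t / 2" for t
  define a where "a = - 1 / (real k - 1)"
  have k1: "real k - 1 > 0" using assms by simp
  have u1: "1 \<le> u t" if "0 \<le> t" for t using that k1 by (simp add: u_def)
  have \<beta>: "tree_beta k t = u t powr a" for t by (simp add: tree_beta_def u_def a_def)
  have du: "(u has_real_derivative (real k - 1) / 2) (at t)" for t
    unfolding u_def[abs_def] by (auto intro!: derivative_eq_intros)
  have pos: "0 < tree_beta k t" if "0 \<le> t" for t using u1[OF that] by (simp add: \<beta>)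
  have d\<beta>: "(tree_beta k has_real_derivative - (tree_beta k t ^ k) / 2) (at t)" if "0 \<le> t" for t
  proof -
    have "((\<lambda>t. u t powr a) has_real_derivative a * u t powr (a - 1) * ((real k - 1) / 2)) (at t)"
    proof -
      have "u t > 0" using u1[OF that] by simp
      from DERIV_chain2[OF has_real_derivative_powr[OF this, of a] du[of t]] show ?thesis .
    qed
    moreover have "a * u t powr (a - 1) * ((real k - 1) / 2) = - (tree_beta k t ^ k) / 2"
    proof -
      have "a - 1 = a * real k" using k1 by (simp add: a_def divide_simps)
      then have "u t powr (a - 1) = tree_beta k t ^ k"
        using u1[OF that] by (simp add: \<beta> powr_power mult.commute)
      then show ?thesis using k1 by (simp add: a_def)
    qed
    ultimately show ?thesis by (simp add: \<beta>[abs_def])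
  qed
  show ?thesis
  proof (rule limit_lawsI)
    show "1 \<le> k" using assms by simp
    show "(tree_beta k has_real_derivative - (tree_beta k t ^ k) / 2) (at t)" if "0 \<le> t" for t
      by (rule d\<beta>[OF that])
    show "tree_beta k 0 = 1" "2 * ln (tree_beta k 0) = 0" by (simp_all add: tree_beta_def)
    show "0 \<le> tree_beta k t \<and> tree_beta k t \<le> 1" if "0 \<le> t" for t
      using powr_mono[of a 0 "u t"] u1[OF that] k1 by (simp add: \<beta> a_def)
    show "((\<lambda>t. 2 * ln (tree_beta k t)) has_real_derivative - (tree_beta k t ^ (k - 1))) (at t)" if "0 \<le> t" for t
    proof -
      have "((\<lambda>t. 2 * ln (tree_beta k t)) has_real_derivative
          2 * (1 / tree_beta k t * (- (tree_beta k t ^ k) / 2))) (at t)"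
        by (intro DERIV_cmult DERIV_chain2[OF DERIV_ln_divide[OF pos[OF that]] d\<beta>[OF that]])
      moreover have "tree_beta k t ^ k = tree_beta k t * tree_beta k t ^ (k - 1)"
        using assms by (cases k) auto
      ultimately show ?thesis using pos[OF that] by simp
    qed
    show "tree_pair k 0 (2 * ln (tree_beta k t)) = 1 - t" if "0 \<le> t" for t
    proof -
      have "(1 - real k) / 2 * (2 * ln (tree_beta k t)) = ln (u t)"
        using k1 u1[OF that] by (simp add: \<beta> ln_powr a_def divide_simps) (simp add: algebra_simps)
      then have "exp ((1 - real k) / 2 * (2 * ln (tree_beta k t))) = u t"
        using u1[OF that] by simp
      then have "tree_pair k 0 (2 * ln (tree_beta k t)) = (real k + 1) / (real k - 1) + 2 / (1 - real k) * u t"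
        by (simp add: tree_pair_def exp_partial_def)
      also have "\<dots> = 1 - t"
      proof -
        define d where "d = real k - 1"
        have d: "d > 0" "real k + 1 = d + 2" "1 - real k = - d" using k1 by (simp_all add: d_def)
        have "(d + 2) / d + 2 / (- d) * (1 + d * t / 2) = 1 - t"
          using d(1) by (simp add: field_simps)
        then show ?thesis unfolding u_def d(2,3) d_def[symmetric] .
      qed
      finally show ?thesis .
    qed
    show "isCont (tree_pair k 0) x" for x
      unfolding tree_pair_def[abs_def] exp_partial_def[abs_def] using assms by (auto intro!: continuous_intros)
    show "tree_pair k (Suc n) 0 = 1" for n
      by (simp add: tree_pair_def exp_partial_0)
  qed (rule tree_pair_deriv[OF assms])
qed

section \<open>The process on regular trees\<close>

lemma least_walk_path:
  assumes walk: "(u, v) \<in> adj F ^^ n" and least: "\<And>m. m < n \<Longrightarrow> (u, v) \<notin> adj F ^^ m"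
  obtains xs where "length xs = Suc n" "hd xs = u" "last xs = v" "path_in F xs"
proof -
  obtain p where p: "p 0 = u" "p n = v" "\<And>i. i < n \<Longrightarrow> (p i, p (Suc i)) \<in> adj F"
    using walk unfolding relpow_fun_conv by blast
  have seg: "(p i, p (i + d)) \<in> adj F ^^ d" if "i + d \<le> n" for i d
    unfolding relpow_fun_conv using that p(3)
    by (intro exI[of _ "\<lambda>j. p (i + j)"]) auto
  have "p i \<noteq> p j" if "i < j" "j \<le> n" for i j
  proof
    assume eq: "p i = p j"
    have "(u, p i) \<in> adj F ^^ i" using seg[of 0 i] that p(1) by simp
    moreover have "(p i, v) \<in> adj F ^^ (n - j)" using seg[of j "n - j"] that p(2) eq by simp
    ultimately have "(u, v) \<in> adj F ^^ (i + (n - j))" unfolding relpow_add by (rule relcompI)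
    with least[of "i + (n - j)"] that show False by simp
  qed
  then have inj: "inj_on p {0..<Suc n}"
    by (intro linorder_inj_onI) auto
  show thesis
  proof (rule that[of "map p [0..<Suc n]"])
    show "path_in F (map p [0..<Suc n])"
      unfolding path_in_def successively_conv_nth
      using p(3) inj by (auto simp: distinct_map adj_def simp del: upt_Suc)
  qed (use p in \<open>auto simp: hd_map last_map simp del: upt_Suc\<close>)
qed

text \<open>A shortest walk from \<open>y\<close> to \<open>v\<close> that avoids the edge repeats no vertex; closing it up with the edge gives a cycle.\<close>

lemma tree_bridge:
  assumes acyclic: "\<nexists>c. graph_cycle E c" and edge: "{v, y} \<in> E" and vy: "v \<noteq> y"
  shows "(y, v) \<notin> connected_in (E - {{v, y}})"
proof
  let ?F = "E - {{v, y}}"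
  assume "(y, v) \<in> connected_in ?F"
  then have ex: "\<exists>n. (y, v) \<in> adj ?F ^^ n" by (simp add: connected_in_def rtrancl_power)
  define n where "n = (LEAST n. (y, v) \<in> adj ?F ^^ n)"
  have n: "(y, v) \<in> adj ?F ^^ n" unfolding n_def using ex by (rule LeastI_ex)
  have least: "(y, v) \<notin> adj ?F ^^ m" if "m < n" for m
    using that unfolding n_def by (rule not_less_Least)
  obtain xs where xs: "length xs = Suc n" "hd xs = y" "last xs = v" "path_in ?F xs"
    using least_walk_path[OF n least] by blast
  have "n \<noteq> 0" using n vy by (cases n) auto
  moreover have "n \<noteq> 1"
  proof
    assume "n = 1"
    with n have "{y, v} \<in> ?F" by (simp add: adj_def)
    then show False by (simp add: insert_commute)
  qed
  ultimately have len: "3 \<le> length xs" using xs(1) by simp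
  have "xs \<noteq> []" using xs(1) by auto
  then have "xs ! 0 = y" "xs ! n = v"
    using xs(1-3) by (metis hd_conv_nth, metis last_conv_nth diff_Suc_1)
  then have close: "{xs ! n, xs ! 0} \<in> E" using edge by simp
  have "{xs ! i, xs ! (Suc i mod length xs)} \<in> E" if "i < length xs" for i
  proof (cases "i = n")
    case True
    then show ?thesis using close xs(1) by simp
  next
    case False
    then have "Suc i < length xs" using that xs(1) by simp
    then show ?thesis using xs(4) by (auto simp: path_in_def successively_conv_nth)
  qed
  then have "graph_cycle E xs" using len xs(4) by (simp add: graph_cycle_def path_in_def)
  with acyclic show False by blast
qed

lemma annihilation_forestI:
  assumes "annihilation M E \<tau> \<kappa>" "tree V E" "exhaustion V W" "limit_laws k \<beta> f"
    and deg: "\<And>v. v \<in> V \<Longrightarrow> 1 \<le> degree E v \<and> degree E v \<le> k + 1"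
  shows "annihilation_forest M E \<tau> \<kappa> k (\<lambda>n. induced_edges E (W n)) \<beta> f"
proof -
  interpret annihilation M E \<tau> \<kappa> by fact
  interpret limit_laws k \<beta> f by fact
  have simple: "e \<subseteq> V" "card e = 2" if "e \<in> E" for e
    using that assms(2) by (auto simp: tree_def simple_graph_def)
  have finW: "finite (W n)" for n using assms(3) by (simp add: exhaustion_def)
  have ex: "(\<Union>n. \<Inter>m\<in>{n..}. W m) = V" using assms(3) by (simp add: exhaustion_def)
  have evW: "eventually (\<lambda>n. v \<in> W n) sequentially" if "v \<in> V" for v
  proof -
    have "v \<in> (\<Union>n. \<Inter>m\<in>{n..}. W m)" using that ex by simp
    then show ?thesis unfolding eventually_sequentially by auto
  qed
  have incident: "finite {e\<in>E. v \<in> e} \<and> card {e\<in>E. v \<in> e} \<le> k + 1" for v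
  proof (cases "v \<in> V")
    case True
    then show ?thesis using deg[OF True] unfolding degree_def by (metis card_ge_0_finite less_eq_Suc_le One_nat_def)
  next
    case False
    then have "{e\<in>E. v \<in> e} = {}" using simple by auto
    then show ?thesis by (simp only: finite.emptyI card.empty simp_thms le0)
  qed
  show ?thesis
  proof unfold_locales
    show "card e = 2" if "e \<in> E" for e using simple that by simp
    show "finite (induced_edges E (W n))" for n
      by (rule finite_subset[of _ "Pow (W n)"]) (auto simp: induced_edges_def finW)
    show "induced_edges E (W n) \<subseteq> E" for n by (auto simp: induced_edges_def)
    show "eventually (\<lambda>n. e \<in> induced_edges E (W n)) sequentially" if "e \<in> E" for e
    proof -
      have "finite e" using simple[OF that] by (metis card.infinite zero_neq_numeral)
      then have "eventually (\<lambda>n. \<forall>v\<in>e. v \<in> W n) sequentially"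
        using evW simple(1)[OF that] by (intro eventually_ball_finite) auto
      then show ?thesis by eventually_elim (use that in \<open>auto simp: induced_edges_def\<close>)
    qed
    show "finite {e\<in>E. v \<in> e}" "card {e\<in>E. v \<in> e} \<le> k + 1" for v using incident by auto
    show "(y, v) \<notin> connected_in (E - {{v, y}})" if "{v, y} \<in> E" for v y
    proof (rule tree_bridge)
      show "v \<noteq> y" using simple(2)[OF that] by auto
    qed (use assms(2) that in \<open>auto simp: tree_def\<close>)
  qed
qed

context annihilation_limit
begin

definition state :: "real \<Rightarrow> 'a \<Rightarrow> '\<omega> \<Rightarrow> real" where
  "state t v \<omega> = lim (\<lambda>n. of_bool (occupied_at (G n) (\<lambda>e. \<tau> e \<omega>) (\<lambda>e. \<kappa> e \<omega>) t v))"

lemma G_inter: "E \<inter> G n = G n"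
  using G_subset by auto

text \<open>The state is almost surely equal to a limit of events at the fixed time \<open>t\<close>, but the probability of a set is
  meaningful only if the set itself is measurable.\<close>

lemma state_measurable: "state t v \<in> borel_measurable M"
proof -
  have "Measurable.pred M (\<lambda>\<omega>. occupied_at (G n) (\<lambda>e. \<tau> e \<omega>) (\<lambda>e. \<kappa> e \<omega>) t v)" for n
  proof -
    have eq: "occupied_at (G n) (\<lambda>e. \<tau> e \<omega>) (\<lambda>e. \<kappa> e \<omega>) t v \<longleftrightarrow>
        (\<forall>e\<in>{e\<in>G n. v \<in> e}. \<not> (\<tau> e \<omega> \<le> t \<and> \<kappa> e \<omega> = v \<and> (\<forall>u\<in>e. occ (G n) (\<tau> e \<omega>) u \<omega>)))" for \<omega>
      unfolding occupied_at_def occ_def by blast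
    have 1: "Measurable.pred M (\<lambda>\<omega>. \<tau> e \<omega> \<le> t)" if "e \<in> E" for e
      using \<tau>_measurable[OF that] by measurable
    have 2: "Measurable.pred M (\<lambda>\<omega>. \<kappa> e \<omega> = v)" if "e \<in> E" for e
    proof -
      have "\<kappa> e \<in> M \<rightarrow>\<^sub>M count_space e"
        using measurable_compose[OF edge_measurable measurable_snd, of e] that by auto
      from measurable_compose[OF this, of "\<lambda>x. x = v" "count_space UNIV"] show ?thesis by simp
    qed
    have 3: "Measurable.pred M (\<lambda>\<omega>. \<forall>u\<in>e. occ (G n) (\<tau> e \<omega>) u \<omega>)" if "e \<in> E" for e
      using finite_edge[OF that] finite_G G_subset that
      by (intro pred_intros_finite(3) pred_occ_\<tau>) auto
    have "Measurable.pred M (\<lambda>\<omega>. \<not> (\<tau> e \<omega> \<le> t \<and> \<kappa> e \<omega> = v \<and> (\<forall>u\<in>e. occ (G n) (\<tau> e \<omega>) u \<omega>)))" if "e \<in> E" for e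
      by (intro pred_intros_logic 1 2 3 that)
    then show ?thesis
      unfolding eq using finite_G G_subset by (intro pred_intros_finite(3)) auto
  qed
  from measurable_compose[OF this, of of_bool borel]
  show ?thesis unfolding state_def[abs_def] by (intro borel_measurable_lim_metric) simp
qed

text \<open>\<open>occupied_at\<close> and \<open>occupied_before\<close> differ only if some clock equals \<open>t\<close>, which is excluded almost
  surely for the countably many edges involved.\<close>

lemma state_tendsto:
  assumes "0 \<le> t" "t \<le> 1"
  shows "AE \<omega> in M. (\<lambda>n. of_bool (occ (G n) t v \<omega>)) \<longlonglongrightarrow> state t v \<omega> \<and> state t v \<omega> \<in> {0, 1}"
proof -
  have "AE \<omega> in M. \<tau> e \<omega> \<noteq> t" if "e \<in> E" for e
    using prob_\<tau>_eq[OF that, of t] \<tau>_measurable[OF that] by (subst (asm) prob_Collect_eq_0) auto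
  then have "AE \<omega> in M. \<forall>e\<in>(\<Union>n. G n). \<tau> e \<omega> \<noteq> t"
    using finite_G G_subset by (subst AE_ball_countable) (auto intro: countable_finite)
  moreover have "AE \<omega> in M. \<exists>b. eventually (\<lambda>n. occ (E \<inter> G n) t v \<omega> = b) sequentially"
    using assms by (intro occ_eventually_const) auto
  ultimately show ?thesis
  proof eventually_elim
    case (elim \<omega>)
    have "occupied_at (G n) (\<lambda>e. \<tau> e \<omega>) (\<lambda>e. \<kappa> e \<omega>) t v = occ (G n) t v \<omega>" for n
      unfolding occ_def using elim(1) finite_G by (intro occupied_at_eq_before) auto
    then have st: "state t v \<omega> = lim (\<lambda>n. of_bool (occ (G n) t v \<omega>))"
      by (simp add: state_def)
    obtain b where "eventually (\<lambda>n. occ (G n) t v \<omega> = b) sequentially"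
      using elim(2) unfolding G_inter by blast
    then have "eventually (\<lambda>n. (of_bool (occ (G n) t v \<omega>) :: real) = of_bool b) sequentially"
      by eventually_elim simp
    then have lim: "(\<lambda>n. of_bool (occ (G n) t v \<omega>) :: real) \<longlonglongrightarrow> of_bool b"
      by (rule tendsto_eventually)
    then have "state t v \<omega> = of_bool b" unfolding st by (rule limI)
    with lim show ?case by simp
  qed
qed

lemma expectation_limit:
  assumes X: "X \<in> borel_measurable M" and t: "0 \<le> t" "t \<le> 1" and "finite S"
    and conv: "AE \<omega> in M. (\<lambda>n. of_bool (\<forall>v\<in>S. occ (G n) t v \<omega>)) \<longlonglongrightarrow> X \<omega>"
  shows "expectation X = lim_prob E t S"
proof -
  let ?Y = "\<lambda>\<omega>. lim (\<lambda>n. of_bool (\<forall>v\<in>S. occ (G n) t v \<omega>)) :: real"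
  have pred: "Measurable.pred M (\<lambda>\<omega>. \<forall>v\<in>S. occ (G n) t v \<omega>)" for n
    using assms finite_G G_subset by (intro pred_intros_finite(3) pred_occ_const) auto
  have "?Y \<in> borel_measurable M"
    using measurable_compose[OF pred, of of_bool borel] by (intro borel_measurable_lim_metric) simp
  moreover have "AE \<omega> in M. X \<omega> = ?Y \<omega>"
    using conv by eventually_elim (simp add: limI)
  ultimately have "expectation X = expectation ?Y"
    using X by (intro integral_cong_AE)
  also have "\<dots> = lim_prob E t S"
    using occ_prob_tendsto_integral[of E t S] occ_prob_tendsto[of E t S] assms
    unfolding G_inter by (intro LIMSEQ_unique) auto
  finally show ?thesis .
qed

lemma expectation_state:
  assumes t: "0 \<le> t" "t \<le> 1"
  shows "expectation (state t v) = lim_prob E t {v}"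
    and "expectation (\<lambda>\<omega>. state t v \<omega> * state t w \<omega>) = lim_prob E t {v, w}"
proof -
  show "expectation (state t v) = lim_prob E t {v}"
    using state_tendsto[OF t, of v] by (intro expectation_limit state_measurable t) auto
  show "expectation (\<lambda>\<omega>. state t v \<omega> * state t w \<omega>) = lim_prob E t {v, w}"
  proof (rule expectation_limit)
    show "AE \<omega> in M. (\<lambda>n. of_bool (\<forall>x\<in>{v, w}. occ (G n) t x \<omega>)) \<longlonglongrightarrow> state t v \<omega> * state t w \<omega>"
      using state_tendsto[OF t, of v] state_tendsto[OF t, of w]
    proof eventually_elim
      case (elim \<omega>)
      then have "(\<lambda>n. of_bool (occ (G n) t v \<omega>) * of_bool (occ (G n) t w \<omega>)) \<longlonglongrightarrow> state t v \<omega> * state t w \<omega>"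
        by (intro tendsto_mult) auto
      then show ?case by (simp add: of_bool_conj)
    qed
  qed (use t state_measurable in auto)
qed

lemma prob_state:
  assumes t: "0 \<le> t" "t \<le> 1"
  shows "prob {\<omega>\<in>space M. state t v \<omega> = 1} = lim_prob E t {v}"
proof -
  have [measurable]: "state t v \<in> borel_measurable M" by (rule state_measurable)
  have "expectation (state t v) = expectation (indicator {\<omega>\<in>space M. state t v \<omega> = 1})"
  proof (rule integral_cong_AE)
    show "AE \<omega> in M. state t v \<omega> = indicator {\<omega>\<in>space M. state t v \<omega> = 1} \<omega>"
      using state_tendsto[OF t, of v] AE_space by eventually_elim (auto simp: indicator_def)
  qed measurable
  also have "\<dots> = prob {\<omega>\<in>space M. state t v \<omega> = 1}" by simp
  finally show ?thesis using expectation_state(1)[OF t] by simp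
qed

lemma covariance_state:
  assumes t: "0 \<le> t" "t \<le> 1"
  shows "covariance M (state t v) (state t w) =
    lim_prob E t {v, w} - lim_prob E t {v} * lim_prob E t {w}"
proof -
  have [measurable]: "state t u \<in> borel_measurable M" for u by (rule state_measurable)
  have bound: "AE \<omega> in M. norm (state t u \<omega>) \<le> 1" for u
    using state_tendsto[OF t, of u] by eventually_elim auto
  have int: "integrable M (state t u)" for u
    using bound by (intro integrable_const_bound[where B=1]) auto
  have "AE \<omega> in M. norm (state t v \<omega> * state t w \<omega>) \<le> 1"
    using state_tendsto[OF t, of v] state_tendsto[OF t, of w] by eventually_elim auto
  then have int2: "integrable M (\<lambda>\<omega>. state t v \<omega> * state t w \<omega>)"
    by (intro integrable_const_bound[where B=1]) auto
  define a b where "a = expectation (state t v)" and "b = expectation (state t w)"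
  have "covariance M (state t v) (state t w) =
      expectation (\<lambda>\<omega>. state t v \<omega> * state t w \<omega> - b * state t v \<omega> - a * state t w \<omega> + a * b)"
    unfolding covariance_def a_def b_def by (simp add: algebra_simps)
  also have "\<dots> = expectation (\<lambda>\<omega>. state t v \<omega> * state t w \<omega>) - b * a - a * b + a * b"
    using int int2 by (simp add: a_def b_def prob_space)
  finally show ?thesis
    using expectation_state[OF t] by (simp add: a_def b_def mult.commute)
qed

end

lemma (in annihilation_forest) regular_tree_laws:
  assumes deg: "\<And>v. v \<in> \<Union>E \<Longrightarrow> degree E v = k + 1"
    and conn: "(v, w) \<in> connected_in E" and m: "graph_dist E v w = m" "1 \<le> m"
    and vw: "degree E v = k + 1" "degree E w = k + 1" and t: "0 \<le> t" "t \<le> 1"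
  shows "covariance M (state t v) (state t w) = \<beta> t ^ (2 * k) * (f m t - \<beta> t ^ 2)"
proof -
  have reg: "regular_except E S" for S using deg by (simp add: regular_except_def)
  have ex: "\<exists>n. (v, w) \<in> adj E ^^ n" using conn by (simp add: connected_in_def rtrancl_power)
  have walk: "(v, w) \<in> adj E ^^ m"
    unfolding m(1)[symmetric] graph_dist_def using ex by (rule LeastI_ex)
  have least: "(v, w) \<notin> adj E ^^ n" if "n < m" for n
    using that unfolding m(1)[symmetric] graph_dist_def by (rule not_less_Least)
  obtain xs where xs: "length xs = Suc m" "hd xs = v" "last xs = w" "path_in E xs"
    using least_walk_path[OF walk least] by blast
  have "lim_prob E t {v, w} = \<beta> t ^ (k + k) * f m t"
    using pair_law_holds[OF m(2)] reg[of "{v, w}"] xs vw t unfolding pair_law_def by fastforce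
  moreover have "lim_prob E t {u} = \<beta> t ^ (k + 1)" if "degree E u = k + 1" for u
    using lim_prob_root[OF reg t, of u] that by simp
  moreover have "\<beta> t ^ (2 * k) = \<beta> t ^ k * \<beta> t ^ k" by (simp add: mult_2 power_add)
  ultimately show ?thesis
    using vw by (simp add: covariance_state[OF t] algebra_simps power2_eq_square power_add)
qed

theorem mainTheorem13:
  fixes k :: nat
    and V :: "'a set" and E :: "'a set set" and W :: "nat \<Rightarrow> 'a set"
    and M :: "'\<omega> measure" and \<tau> :: "'a set \<Rightarrow> '\<omega> \<Rightarrow> real" and \<kappa> :: "'a set \<Rightarrow> '\<omega> \<Rightarrow> 'a"
    and V1 :: "'b set" and E1 :: "'b set set" and W1 :: "nat \<Rightarrow> 'b set" and v0 :: 'b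
    and M1 :: "'\<xi> measure" and \<tau>1 :: "'b set \<Rightarrow> '\<xi> \<Rightarrow> real" and \<kappa>1 :: "'b set \<Rightarrow> '\<xi> \<Rightarrow> 'b"
  assumes "k \<ge> 1"
    and "is_T k V E" and "exhaustion V W" and "annihilation M E \<tau> \<kappa>"
    and "is_T1 k V1 E1 v0" and "exhaustion V1 W1" and "annihilation M1 E1 \<tau>1 \<kappa>1"
  shows
    "let X = ann_state E W \<tau> \<kappa>;
         X1 = ann_state E1 W1 \<tau>1 \<kappa>1;
         \<alpha> = (\<lambda>v t. \<P>(\<omega> in M. X t v \<omega> = 1));
         \<beta> = (\<lambda>t. \<P>(\<omega> in M1. X1 t v0 \<omega> = 1))
     in
       (k \<ge> 2 \<longrightarrow>
         (\<forall>t\<in>{0..1}.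
            \<beta> t = (1 + (real k - 1) * t / 2) powr (- 1 / (real k - 1)) \<and>
            (\<forall>v\<in>V. \<alpha> v t = (1 + (real k - 1) * t / 2) powr (- (real k + 1) / (real k - 1))) \<and>
            (\<forall>m\<ge>1. \<forall>v\<in>V. \<forall>w\<in>V. graph_dist E v w = m \<longrightarrow>
               covariance M (X t v) (X t w) =
                 \<beta> t ^ (2 * k) *
                   ((real k + 1) * (2 * ln (\<beta> t)) ^ (m - 1) / (fact (m - 1) * (real k - 1))
                    - (\<Sum>\<^sub>\<infinity>j\<in>{m - 1..}.
                         (2 * ln (\<beta> t)) ^ j / fact j
                         - (2 / (1 - real k)) ^ m * ((1 - real k) * ln (\<beta> t)) ^ j / fact j))))) \<and>
       (k = 1 \<longrightarrow>
         (\<forall>t\<in>{0..1}.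
            \<beta> t = exp (- t / 2) \<and>
            (\<forall>v\<in>V. \<alpha> v t = exp (- t)) \<and>
            (\<forall>m\<ge>1. \<forall>v\<in>V. \<forall>w\<in>V. graph_dist E v w = m \<longrightarrow>
               covariance M (X t v) (X t w) =
                 - exp (- t) * (\<Sum>\<^sub>\<infinity>j\<in>{m + 1..}. (- t) ^ j / fact j))))"
proof -
  have T: "tree V E" "\<And>v. v \<in> V \<Longrightarrow> degree E v = k + 1" using assms(2) by (auto simp: is_T_def)
  have T1: "tree V1 E1" "v0 \<in> V1" "degree E1 v0 = 1"
    "\<And>v. v \<in> V1 \<Longrightarrow> v \<noteq> v0 \<Longrightarrow> degree E1 v = k + 1"
    using assms(5) by (auto simp: is_T1_def)
  have EV: "\<Union>E \<subseteq> V" "\<Union>E1 \<subseteq> V1"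
    using T(1) T1(1) by (auto simp: tree_def simple_graph_def)
  have laws: "\<P>(\<omega> in M1. ann_state E1 W1 \<tau>1 \<kappa>1 t v0 \<omega> = 1) = B t \<and>
      (\<forall>v\<in>V. \<P>(\<omega> in M. ann_state E W \<tau> \<kappa> t v \<omega> = 1) = B t ^ (k + 1)) \<and>
      (\<forall>m\<ge>1. \<forall>v\<in>V. \<forall>w\<in>V. graph_dist E v w = m \<longrightarrow>
        covariance M (ann_state E W \<tau> \<kappa> t v) (ann_state E W \<tau> \<kappa> t w) = B t ^ (2 * k) * (f m t - B t ^ 2))"
    if lim: "limit_laws k B f" and t: "t \<in> {0..1}" for B f t
  proof (intro conjI ballI allI impI)
    interpret A: annihilation_forest M E \<tau> \<kappa> k "\<lambda>n. induced_edges E (W n)" B f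
      using T by (intro annihilation_forestI[OF assms(4) T(1) assms(3) lim]) auto
    interpret A1: annihilation_forest M1 E1 \<tau>1 \<kappa>1 k "\<lambda>n. induced_edges E1 (W1 n)" B f
    proof (rule annihilation_forestI[OF assms(7) T1(1) assms(6) lim])
      show "1 \<le> degree E1 v \<and> degree E1 v \<le> k + 1" if "v \<in> V1" for v
        using T1(3,4) that by (cases "v = v0") auto
    qed
    have st: "A.state s v = ann_state E W \<tau> \<kappa> s v" for s v
      by (simp add: fun_eq_iff A.state_def ann_state_def)
    have st1: "A1.state s v = ann_state E1 W1 \<tau>1 \<kappa>1 s v" for s v
      by (simp add: fun_eq_iff A1.state_def ann_state_def)
    have t': "0 \<le> t" "t \<le> 1" using t by auto
    have "A1.regular_except E1 {v0}"
      using T1(4) EV(2) by (auto simp: A1.regular_except_def)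
    then show "\<P>(\<omega> in M1. ann_state E1 W1 \<tau>1 \<kappa>1 t v0 \<omega> = 1) = B t"
      using A1.prob_state[OF t', of v0] A1.lim_prob_root[of E1 v0, OF _ t'] T1(3) unfolding st1 by simp
    have reg: "A.regular_except E S" for S
      using T(2) EV(1) by (auto simp: A.regular_except_def)
    show "\<P>(\<omega> in M. ann_state E W \<tau> \<kappa> t v \<omega> = 1) = B t ^ (k + 1)" if "v \<in> V" for v
      using A.prob_state[OF t', of v] A.lim_prob_root[OF reg t', of v] T(2)[OF that] unfolding st by simp
    show "covariance M (ann_state E W \<tau> \<kappa> t v) (ann_state E W \<tau> \<kappa> t w) = B t ^ (2 * k) * (f m t - B t ^ 2)"
      if "1 \<le> m" "v \<in> V" "w \<in> V" "graph_dist E v w = m" for m v w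
    proof -
      have "(v, w) \<in> connected_in E"
        using T(1) that by (auto simp: tree_def connected_graph_def connected_in_def)
      from A.regular_tree_laws[OF _ this that(4,1) _ _ t'] show ?thesis
        using T(2) EV(1) that unfolding st by auto
    qed
  qed
  show ?thesis
    unfolding Let_def
  proof (intro conjI impI)
    assume k: "2 \<le> k"
    define q where "q = 2 / (1 - real k)"
    show "\<forall>t\<in>{0..1}.
            \<P>(\<omega> in M1. ann_state E1 W1 \<tau>1 \<kappa>1 t v0 \<omega> = 1) = (1 + (real k - 1) * t / 2) powr (- 1 / (real k - 1)) \<and>
            (\<forall>v\<in>V. \<P>(\<omega> in M. ann_state E W \<tau> \<kappa> t v \<omega> = 1) = (1 + (real k - 1) * t / 2) powr (- (real k + 1) / (real k - 1))) \<and>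
            (\<forall>m\<ge>1. \<forall>v\<in>V. \<forall>w\<in>V. graph_dist E v w = m \<longrightarrow>
               covariance M (ann_state E W \<tau> \<kappa> t v) (ann_state E W \<tau> \<kappa> t w) =
                 \<P>(\<omega> in M1. ann_state E1 W1 \<tau>1 \<kappa>1 t v0 \<omega> = 1) ^ (2 * k) *
                   ((real k + 1) * (2 * ln \<P>(\<omega> in M1. ann_state E1 W1 \<tau>1 \<kappa>1 t v0 \<omega> = 1)) ^ (m - 1) / (fact (m - 1) * (real k - 1))
                    - (\<Sum>\<^sub>\<infinity>j\<in>{m - 1..}.
                         (2 * ln \<P>(\<omega> in M1. ann_state E1 W1 \<tau>1 \<kappa>1 t v0 \<omega> = 1)) ^ j / fact j
                         - (2 / (1 - real k)) ^ m * ((1 - real k) * ln \<P>(\<omega> in M1. ann_state E1 W1 \<tau>1 \<kappa>1 t v0 \<omega> = 1)) ^ j / fact j)))"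
    proof
      fix t :: real assume t: "t \<in> {0..1}"
      let ?b = "tree_beta k t"
      have u: "1 \<le> 1 + (real k - 1) * t / 2" using k t by simp
      have pos: "0 < ?b" using u by (simp add: tree_beta_def)
      have 1: "\<P>(\<omega> in M1. ann_state E1 W1 \<tau>1 \<kappa>1 t v0 \<omega> = 1) = ?b"
        using laws[OF limit_laws_tree[OF k] t] by blast
      have 2: "?b ^ (k + 1) = (1 + (real k - 1) * t / 2) powr (- (real k + 1) / (real k - 1))"
      proof -
        have "?b ^ (k + 1) = (1 + (real k - 1) * t / 2) powr (real (k + 1) * (- 1 / (real k - 1)))"
          unfolding tree_beta_def using u by (intro powr_power) auto
        also have "real (k + 1) * (- 1 / (real k - 1)) = - (real k + 1) / (real k - 1)"
          by (simp only: times_divide_eq_right mult_minus1_right of_nat_add of_nat_1)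
        finally show ?thesis .
      qed
      have 3: "tree_pair k (m - 1) (2 * ln ?b) - ?b ^ 2 =
          (real k + 1) * (2 * ln ?b) ^ (m - 1) / (fact (m - 1) * (real k - 1))
          - (\<Sum>\<^sub>\<infinity>j\<in>{m - 1..}. (2 * ln ?b) ^ j / fact j - (2 / (1 - real k)) ^ m * ((1 - real k) * ln ?b) ^ j / fact j)"
        if m: "1 \<le> m" for m
      proof -
        obtain n where n: "m = Suc n" using m by (cases m) auto
        define L where "L = 2 * ln ?b"
        have L: "(1 - real k) * ln ?b = (1 - real k) / 2 * L" by (simp add: L_def)
        have "?b ^ 2 = exp L"
          using pos by (simp add: L_def exp_double)
        moreover have "(\<Sum>\<^sub>\<infinity>j\<in>{n..}. L ^ j / fact j - q ^ m * ((1 - real k) / 2 * L) ^ j / fact j) =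
            (exp L - exp_partial n L) - q ^ m * (exp ((1 - real k) / 2 * L) - exp_partial n ((1 - real k) / 2 * L))"
        proof -
          have "((\<lambda>j. L ^ j / fact j + - (q ^ m) * (((1 - real k) / 2 * L) ^ j / fact j)) has_sum
              (exp L - (\<Sum>j<n. L ^ j / fact j)) + - (q ^ m) *
                (exp ((1 - real k) / 2 * L) - (\<Sum>j<n. ((1 - real k) / 2 * L) ^ j / fact j))) {n..}"
            by (intro has_sum_add has_sum_cmult_right exp_tail_has_sum)
          then have "((\<lambda>j. L ^ j / fact j - q ^ m * ((1 - real k) / 2 * L) ^ j / fact j) has_sum
              (exp L - exp_partial n L) - q ^ m * (exp ((1 - real k) / 2 * L) - exp_partial n ((1 - real k) / 2 * L))) {n..}"
            by (simp only: exp_partial_def times_divide_eq_right mult_minus_left add_uminus_conv_diff minus_divide_left[symmetric])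
          then show ?thesis by (rule infsumI)
        qed
        ultimately show ?thesis
          unfolding L L_def[symmetric] n q_def[symmetric]
          by (simp add: tree_pair_def n q_def[symmetric] mult.commute)
      qed
      show "\<P>(\<omega> in M1. ann_state E1 W1 \<tau>1 \<kappa>1 t v0 \<omega> = 1) = (1 + (real k - 1) * t / 2) powr (- 1 / (real k - 1)) \<and>
            (\<forall>v\<in>V. \<P>(\<omega> in M. ann_state E W \<tau> \<kappa> t v \<omega> = 1) = (1 + (real k - 1) * t / 2) powr (- (real k + 1) / (real k - 1))) \<and>
            (\<forall>m\<ge>1. \<forall>v\<in>V. \<forall>w\<in>V. graph_dist E v w = m \<longrightarrow>
               covariance M (ann_state E W \<tau> \<kappa> t v) (ann_state E W \<tau> \<kappa> t w) =
                 \<P>(\<omega> in M1. ann_state E1 W1 \<tau>1 \<kappa>1 t v0 \<omega> = 1) ^ (2 * k) *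
                   ((real k + 1) * (2 * ln \<P>(\<omega> in M1. ann_state E1 W1 \<tau>1 \<kappa>1 t v0 \<omega> = 1)) ^ (m - 1) / (fact (m - 1) * (real k - 1))
                    - (\<Sum>\<^sub>\<infinity>j\<in>{m - 1..}.
                         (2 * ln \<P>(\<omega> in M1. ann_state E1 W1 \<tau>1 \<kappa>1 t v0 \<omega> = 1)) ^ j / fact j
                         - (2 / (1 - real k)) ^ m * ((1 - real k) * ln \<P>(\<omega> in M1. ann_state E1 W1 \<tau>1 \<kappa>1 t v0 \<omega> = 1)) ^ j / fact j)))"
        unfolding 1 2[symmetric]
        using laws[OF limit_laws_tree[OF k] t] 3 by (simp add: tree_beta_def)
    qed
  next
    assume k: "k = 1"
    show "\<forall>t\<in>{0..1}.
            \<P>(\<omega> in M1. ann_state E1 W1 \<tau>1 \<kappa>1 t v0 \<omega> = 1) = exp (- t / 2) \<and>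
            (\<forall>v\<in>V. \<P>(\<omega> in M. ann_state E W \<tau> \<kappa> t v \<omega> = 1) = exp (- t)) \<and>
            (\<forall>m\<ge>1. \<forall>v\<in>V. \<forall>w\<in>V. graph_dist E v w = m \<longrightarrow>
               covariance M (ann_state E W \<tau> \<kappa> t v) (ann_state E W \<tau> \<kappa> t w) =
                 - exp (- t) * (\<Sum>\<^sub>\<infinity>j\<in>{m + 1..}. (- t) ^ j / fact j))"
    proof
      fix t :: real assume t: "t \<in> {0..1}"
      have 1: "exp (- t / 2) ^ 2 = exp (- t)" by (simp flip: exp_double)
      have 2: "exp (- t / 2) ^ (1 + 1) = exp (- t)" "exp (- t / 2) ^ (2 * 1) = exp (- t)"
        using 1 by (simp_all add: power2_eq_square)
      have "exp (- t) * (exp_partial (Suc (Suc (m - 1))) (- t) - exp (- t)) =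
          - exp (- t) * (\<Sum>\<^sub>\<infinity>j\<in>{m + 1..}. (- t) ^ j / fact j)" if "1 \<le> m" for m
        using that by (simp add: infsum_exp_tail algebra_simps)
      then show "\<P>(\<omega> in M1. ann_state E1 W1 \<tau>1 \<kappa>1 t v0 \<omega> = 1) = exp (- t / 2) \<and>
            (\<forall>v\<in>V. \<P>(\<omega> in M. ann_state E W \<tau> \<kappa> t v \<omega> = 1) = exp (- t)) \<and>
            (\<forall>m\<ge>1. \<forall>v\<in>V. \<forall>w\<in>V. graph_dist E v w = m \<longrightarrow>
               covariance M (ann_state E W \<tau> \<kappa> t v) (ann_state E W \<tau> \<kappa> t w) =
                 - exp (- t) * (\<Sum>\<^sub>\<infinity>j\<in>{m + 1..}. (- t) ^ j / fact j))"
        using laws[unfolded k, OF limit_laws_line t] unfolding 1 2 by simp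
    qed
  qed
qed

end
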